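(* Let $G$ be a locally compact abelian group and $\mu\in\mathcal{M}^\infty(G)$. (a) The following assertions are equivalent: (i) $\mu\in\mathcal{WAP}(G)$. (ii) The hull $\mathbb{X}(\mu)$ agrees with the closure of $\{T^t\mu: t\in G\}$ in the weak topology for measures and is, in particular, compact in the weak topology. (iii) The vague topology and the weak topology agree on $\mathbb{X}(\mu)$. (iv) $\mathbb{X}(\mu)\subset\mathcal{WAP}(G)$. (b) The following assertions are equivalent: (i) $\mu\in\mathcal{SAP}(G)$. (ii) The hull $\mathbb{X}(\mu)$ agrees with the closure of $\{T^t\mu: t\in G\}$ in the product topology for measures and is, in particular, compact in the product topology. (iii) The vague topology and the product topology agree on $\mathbb{X}(\mu)$. (iv) $\mathbb{X}(\mu)\subset\mathcal{SAP}(G)$.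
   Context: $C_c(G)$ is the space of continuous compactly supported functions on $G$, and $C_u(G)$ the Banach space of bounded uniformly continuous complex functions on $G$ with the sup norm. A measure on $G$ is a (complex) Radon measure, i.e. a linear functional on $C_c(G)$ continuous in the inductive limit topology; the vague topology is the weak-* topology of this duality. A measure $\mu$ is translation bounded if $\sup_{x\in G}|\mu|(x+K)<\infty$ for every compact $K\subset G$, where $|\mu|$ is the variation measure; $\mathcal{M}^\infty(G)$ is the space of such measures. For $c\in C_c(G)$, $(c*\mu)(x)=\int_G c(x-t)\,d\mu(t)$ (for translation bounded $\mu$ this lies in $C_u(G)$). Translations are $T^tf(x)=f(x-t)$ and $T^t\mu=\delta_t*\mu$. The hull of $\mu\in\mathcal{M}^\infty(G)$ is $\mathbb{X}(\mu)=\overline{\{T^t\mu:t\in G\}}$ (closure in the vague topology); it is vaguely compact. The product topology for measures is the locally convex topology on $\mathcal{M}^\infty(G)$ given by the seminorms $\|\mu\|_c=\|c*\mu\|_\infty$, $c\in C_c(G)$ (i.e. induced by the embedding $\mu\mapsto(c*\mu)_{c}$ into $C_u(G)^{C_c(G)}$). The weak topology for measures is the weak topology of this locally convex space. A function $f\in C_u(G)$ is Bohr almost periodic (resp. weakly almost periodic) if $\{T^tf: t\in G\}$ is precompact in the norm topology (resp. weak topology) of $C_u(G)$. $\mathcal{SAP}(G)$ (resp. $\mathcal{WAP}(G)$) is the set of $\mu\in\mathcal{M}^\infty(G)$ such that $c*\mu$ is Bohr (resp. weakly) almost periodic for every $c\in C_c(G)$. *)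

theory Defs
  imports "HOL-Analysis.Analysis"
begin

section \<open>Locally convex spaces of complex-valued functions\<close>

text \<open>
  All vector spaces below are sets \<open>V\<close> of complex-valued functions on some index type, with
  pointwise operations.  A topology given by a family of seminorms has the balls
  \<open>{y \<in> V. p (y - x) < e}\<close> as a subbase.
\<close>

definition seminorm_topology ::
  "('i \<Rightarrow> complex) set \<Rightarrow> (('i \<Rightarrow> complex) \<Rightarrow> real) set \<Rightarrow> ('i \<Rightarrow> complex) topology" where
  "seminorm_topology V P = topology_generated_by
     (insert V {{y \<in> V. p (\<lambda>i. y i - x i) < e} | p x e. p \<in> P \<and> x \<in> V \<and> 0 < e})"

lemma topspace_seminorm_topology [simp]: "topspace (seminorm_topology V P) = V"
  by (auto simp: seminorm_topology_def)

definition seminorm_on :: "('i \<Rightarrow> complex) set \<Rightarrow> (('i \<Rightarrow> complex) \<Rightarrow> real) \<Rightarrow> bool" where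
  "seminorm_on V p \<longleftrightarrow>
     (\<forall>f\<in>V. 0 \<le> p f) \<and>
     (\<forall>f\<in>V. \<forall>g\<in>V. p (\<lambda>i. f i + g i) \<le> p f + p g) \<and>
     (\<forall>f\<in>V. \<forall>a. p (\<lambda>i. a * f i) = cmod a * p f)"

definition linear_functional_on ::
  "('i \<Rightarrow> complex) set \<Rightarrow> (('i \<Rightarrow> complex) \<Rightarrow> complex) \<Rightarrow> bool" where
  "linear_functional_on V \<phi> \<longleftrightarrow>
     (\<forall>f\<in>V. \<forall>g\<in>V. \<phi> (\<lambda>i. f i + g i) = \<phi> f + \<phi> g) \<and>
     (\<forall>f\<in>V. \<forall>a. \<phi> (\<lambda>i. a * f i) = a * \<phi> f)"

definition dual :: "('i \<Rightarrow> complex) topology \<Rightarrow> (('i \<Rightarrow> complex) \<Rightarrow> complex) set" where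
  "dual X = {\<phi>. linear_functional_on (topspace X) \<phi> \<and> continuous_map X euclidean \<phi>}"

definition weak_topology :: "('i \<Rightarrow> complex) topology \<Rightarrow> ('i \<Rightarrow> complex) topology" where
  "weak_topology X = seminorm_topology (topspace X) {\<lambda>x. cmod (\<phi> x) | \<phi>. \<phi> \<in> dual X}"

definition precompact_in :: "'a topology \<Rightarrow> 'a set \<Rightarrow> bool" where
  "precompact_in X A \<longleftrightarrow> A \<subseteq> topspace X \<and> compactin X (X closure_of A)"


section \<open>Function spaces on the group\<close>

definition supp :: "('g::topological_space \<Rightarrow> complex) \<Rightarrow> 'g set" where
  "supp f = closure {x. f x \<noteq> 0}"

definition Cc :: "('g::topological_space \<Rightarrow> complex) set" where
  "Cc = {f. continuous_on UNIV f \<and> compact (supp f)}"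

definition Cc_in :: "'g::topological_space set \<Rightarrow> ('g \<Rightarrow> complex) set" where
  "Cc_in K = {f \<in> Cc. supp f \<subseteq> K}"

text \<open>Uniform continuity refers to the canonical uniform structure of the topological group.\<close>

definition Cu :: "('g::topological_ab_group_add \<Rightarrow> complex) set" where
  "Cu = {f. bounded (range f) \<and>
            (\<forall>e>0. \<exists>U. open U \<and> 0 \<in> U \<and> (\<forall>x y. x - y \<in> U \<longrightarrow> dist (f x) (f y) < e))}"

text \<open>Only used for bounded functions.\<close>

definition sup_norm :: "('g \<Rightarrow> complex) \<Rightarrow> real" where
  "sup_norm f = (SUP x. cmod (f x))"

definition Cu_topology :: "('g::topological_ab_group_add \<Rightarrow> complex) topology" where
  "Cu_topology = seminorm_topology Cu {sup_norm}"

text \<open>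
  The inductive limit topology is the finest locally convex topology on \<^term>\<open>Cc\<close> for which all
  inclusions of \<^term>\<open>Cc_in K\<close> (\<open>K\<close> compact, with the sup norm) are continuous, so it is given by
  all seminorms with continuous restrictions to these subspaces.
\<close>

definition Cc_topology :: "('g::topological_space \<Rightarrow> complex) topology" where
  "Cc_topology = seminorm_topology Cc
     {p. seminorm_on Cc p \<and>
         (\<forall>K. compact K \<longrightarrow>
            continuous_map (seminorm_topology (Cc_in K) {sup_norm}) euclidean p)}"

definition translate :: "'g::ab_group_add \<Rightarrow> ('g \<Rightarrow> complex) \<Rightarrow> 'g \<Rightarrow> complex" where
  "translate t f = (\<lambda>x. f (x - t))"

definition bohr_almost_periodic :: "('g::topological_ab_group_add \<Rightarrow> complex) \<Rightarrow> bool" where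
  "bohr_almost_periodic f \<longleftrightarrow>
     f \<in> Cu \<and> precompact_in Cu_topology (range (\<lambda>t. translate t f))"

definition weakly_almost_periodic :: "('g::topological_ab_group_add \<Rightarrow> complex) \<Rightarrow> bool" where
  "weakly_almost_periodic f \<longleftrightarrow>
     f \<in> Cu \<and> precompact_in (weak_topology Cu_topology) (range (\<lambda>t. translate t f))"


section \<open>Measures\<close>

text \<open>
  A functional on \<^term>\<open>Cc\<close> is represented by a total function that vanishes outside
  \<^term>\<open>Cc\<close>; equality of measures is then equality of functions.
\<close>

type_synonym 'g functional = "('g \<Rightarrow> complex) \<Rightarrow> complex"

definition radon_measures :: "'g::topological_space functional set" where
  "radon_measures = {\<mu> \<in> dual Cc_topology. \<forall>f. f \<notin> Cc \<longrightarrow> \<mu> f = 0}"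

definition vague_topology :: "'g::topological_space functional topology" where
  "vague_topology = seminorm_topology radon_measures {\<lambda>\<mu>. cmod (\<mu> f) | f. f \<in> Cc}"

text \<open>
  The variation measure: its value on an open set \<open>U\<close> is the supremum of \<open>\<bar>\<mu> g\<bar>\<close> over \<open>g \<in> Cc\<close>
  with \<open>\<bar>g\<bar> \<le> 1\<close> and support in \<open>U\<close>, and it is outer regular.
\<close>

definition variation :: "'g::topological_space functional \<Rightarrow> 'g set \<Rightarrow> ennreal" where
  "variation \<mu> A =
     (INF U\<in>{U. open U \<and> A \<subseteq> U}.
        SUP g\<in>{g \<in> Cc. (\<forall>x. cmod (g x) \<le> 1) \<and> supp g \<subseteq> U}. ennreal (cmod (\<mu> g)))"

definition tb_measures :: "'g::topological_ab_group_add functional set" where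
  "tb_measures = {\<mu> \<in> radon_measures.
     \<forall>K. compact K \<longrightarrow> (SUP x. variation \<mu> ((\<lambda>k. x + k) ` K)) < \<infinity>}"

definition conv :: "('g::ab_group_add \<Rightarrow> complex) \<Rightarrow> 'g functional \<Rightarrow> 'g \<Rightarrow> complex" where
  "conv c \<mu> = (\<lambda>x. \<mu> (\<lambda>t. c (x - t)))"

text \<open>The convolution of the Dirac measure at \<open>t\<close> with \<open>\<mu>\<close>, that is, \<open>f \<mapsto> \<integral> f (t + s) d\<mu>(s)\<close>.\<close>

definition translate_measure :: "'g::ab_group_add \<Rightarrow> 'g functional \<Rightarrow> 'g functional" where
  "translate_measure t \<mu> = (\<lambda>f. \<mu> (\<lambda>s. f (t + s)))"

definition orbit :: "'g::ab_group_add functional \<Rightarrow> 'g functional set" where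
  "orbit \<mu> = range (\<lambda>t. translate_measure t \<mu>)"

definition vague_hull :: "'g::topological_ab_group_add functional \<Rightarrow> 'g functional set" where
  "vague_hull \<mu> = vague_topology closure_of orbit \<mu>"

definition product_topology_measures :: "'g::topological_ab_group_add functional topology" where
  "product_topology_measures =
     seminorm_topology tb_measures {\<lambda>\<mu>. sup_norm (conv c \<mu>) | c. c \<in> Cc}"

definition weak_topology_measures :: "'g::topological_ab_group_add functional topology" where
  "weak_topology_measures = weak_topology product_topology_measures"

definition SAP :: "'g::topological_ab_group_add functional set" where
  "SAP = {\<mu> \<in> tb_measures. \<forall>c\<in>Cc. bohr_almost_periodic (conv c \<mu>)}"

definition WAP :: "'g::topological_ab_group_add functional set" where
  "WAP = {\<mu> \<in> tb_measures. \<forall>c\<in>Cc. weakly_almost_periodic (conv c \<mu>)}"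

end

theory Submission
  imports Defs "HOL-Library.Function_Algebras"
begin

text \<open>
  On the vague hull, which is compact by Tychonoff, the vague topology is the topology of pointwise
  convergence on \<^term>\<open>Cc\<close>.  If \<open>c * \<mu>\<close> has relatively compact orbit in \<^term>\<open>Cu\<close> (with the norm or
  the weak topology), then pointwise convergence, being coarser and Hausdorff, agrees with the given
  topology on the closure of this orbit, so \<open>\<nu> \<mapsto> c * \<nu>\<close> is continuous on the vague hull.  The product
  topology is initial for these maps by definition; the weak topology is initial for them because, by
  the Hahn-Banach theorem, every functional continuous for the product topology is a finite sum
  \<open>\<nu> \<mapsto> \<Sum>c. \<psi> c (c * \<nu>)\<close> with \<open>\<psi> c\<close> in the dual of \<^term>\<open>Cu\<close>.  Hence the topologies agree on the hull.
  Conversely, if the hull is compact in the finer topology, its image under \<open>\<nu> \<mapsto> c * \<nu>\<close> is a compact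
  set containing the orbit of \<open>c * \<nu>\<close> for every \<open>\<nu>\<close> in the hull.
\<close>

section \<open>The Hahn-Banach theorem\<close>

text \<open>Two obstacles shape the development. For finitely many \<open>c\<close>, the map from a
  measure to the family of its convolutions need not be injective, so a functional bounded by the
  corresponding seminorms is awkward to regard as a functional on the image. Hahn-Banach is
  therefore stated for data pulled back along a map \<open>J\<close> from an arbitrary index set
  \<open>V\<close>; no well-definedness on the image has to be checked. Moreover, a vague limit of
  translates must again be translation bounded, while the variation, an infimum of suprema, does not
  pass to pointwise limits directly. It is traded for the estimates
  \<open>cmod (\<nu> f) \<le> C K * sup_norm f\<close> for \<open>f\<close> supported in any
  translate of \<open>K\<close>. Each of them constrains a single value of \<open>\<nu>\<close> by a
  closed condition, they are uniform in the translate, and local compactness turns them back into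
  finite variation.\<close>

definition sublinear_on :: "'a::real_vector set \<Rightarrow> ('a \<Rightarrow> real) \<Rightarrow> bool" where
  "sublinear_on E p \<longleftrightarrow>
     (\<forall>x\<in>E. \<forall>y\<in>E. p (x + y) \<le> p x + p y) \<and> (\<forall>x\<in>E. \<forall>r>0. p (r *\<^sub>R x) \<le> r * p x)"

text \<open>The definition asks only for \<open>\<le>\<close>, which is what infima deliver. The
  reverse inequality comes from scaling \<open>r *\<^sub>R x\<close> back by
  \<open>1 / r\<close>.\<close>

lemma sublinear_on_scale:
  assumes "subspace E" "sublinear_on E p" "x \<in> E" "0 < r"
  shows "p (r *\<^sub>R x) = r * p x"
proof (rule antisym)
  have "p ((1 / r) *\<^sub>R (r *\<^sub>R x)) \<le> 1 / r * p (r *\<^sub>R x)"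
    using assms(2) subspace_scale[OF assms(1,3)] assms(4)
    unfolding sublinear_on_def by (metis zero_less_divide_1_iff)
  then have "p x \<le> p (r *\<^sub>R x) / r" using assms(4) by simp
  then show "r * p x \<le> p (r *\<^sub>R x)" using assms(4) by (simp add: field_simps)
qed (use assms in \<open>auto simp: sublinear_on_def\<close>)

lemma sublinear_on_zero:
  assumes "subspace E" "sublinear_on E p"
  shows "p 0 = 0"
  using sublinear_on_scale[OF assms subspace_0[OF assms(1)], of 2] by simp

text \<open>Keeps pointwise infima of sublinear functionals \<open>q\<close> below \<open>p\<close>
  finite: \<open>- p (- x) \<le> - q (- x) \<le> q x\<close>.\<close>

lemma sublinear_on_neg_lower:
  assumes "subspace E" "sublinear_on E p" "x \<in> E"
  shows "- p (- x) \<le> p x"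
proof -
  have "p (x + - x) \<le> p x + p (- x)"
    using assms subspace_neg[OF assms(1,3)] unfolding sublinear_on_def by blast
  then show ?thesis using sublinear_on_zero[OF assms(1,2)] by simp
qed

text \<open>Scaling is only required for \<open>r > 0\<close>, so that \<open>J\<close> may also range over a half-line.\<close>

lemma sublinear_on_inf_conv:
  fixes J :: "'v \<Rightarrow> 'a::real_vector"
  assumes E: "subspace E" and q: "sublinear_on E q" and "V \<noteq> {}"
    and J: "\<And>v. v \<in> V \<Longrightarrow> J v \<in> E"
    and add: "\<And>v w. v \<in> V \<Longrightarrow> w \<in> V \<Longrightarrow> \<exists>z\<in>V. J z = J v + J w \<and> u z = u v + u w"
    and scale: "\<And>v r. v \<in> V \<Longrightarrow> 0 < r \<Longrightarrow> \<exists>z\<in>V. J z = r *\<^sub>R J v \<and> u z = r * u v"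
    and le: "\<And>v. v \<in> V \<Longrightarrow> - q (- J v) \<le> u v"
  shows "sublinear_on E (\<lambda>x. INF v\<in>V. q (x - J v) + u v)" (is "sublinear_on E ?h")
    and "\<And>x v. x \<in> E \<Longrightarrow> v \<in> V \<Longrightarrow> (INF v\<in>V. q (x - J v) + u v) \<le> q (x - J v) + u v"
proof -
  have sub: "q (x + y) \<le> q x + q y" if "x \<in> E" "y \<in> E" for x y
    using q that by (simp add: sublinear_on_def)
  \<comment> \<open>A bound independent of \<open>v\<close>, so that the real-valued
    \<open>INF\<close> is a genuine infimum; the hypothesis \<open>le\<close> is made for
    it.\<close>
  have lower: "- q (- x) \<le> q (x - J v) + u v" if "x \<in> E" "v \<in> V" for x v
  proof -
    have "q (- J v) \<le> q (x - J v) + q (- x)"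
      using sub[of "x - J v" "- x"] subspace_diff[OF E that(1) J[OF that(2)]]
        subspace_neg[OF E that(1)] by simp
    then show ?thesis using le[OF that(2)] by linarith
  qed
  then have bdd: "bdd_below ((\<lambda>v. q (x - J v) + u v) ` V)" if "x \<in> E" for x
    using that by (intro bdd_belowI2)
  show upper: "?h x \<le> q (x - J v) + u v" if "x \<in> E" "v \<in> V" for x v
    by (rule cINF_lower[OF bdd[OF that(1)] that(2)])
  show "sublinear_on E ?h"
    unfolding sublinear_on_def
  proof (intro conjI ballI allI impI)
    fix x y assume xy: "x \<in> E" "y \<in> E"
    \<comment> \<open>An index \<open>z\<close> with \<open>J z = J v + J w\<close> competes in the
      infimum for \<open>x + y\<close>. Since \<open>v\<close> and \<open>w\<close> vary
      independently, the two infima on the right can be taken one after the other.\<close>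
    have *: "?h (x + y) \<le> (q (x - J v) + u v) + (q (y - J w) + u w)" if v: "v \<in> V" and w: "w \<in> V" for v w
    proof -
      obtain z where z: "z \<in> V" "J z = J v + J w" "u z = u v + u w" using add[OF v w] by blast
      have "?h (x + y) \<le> q (x + y - J z) + u z" by (rule upper[OF subspace_add[OF E xy] z(1)])
      also have "q (x + y - J z) = q ((x - J v) + (y - J w))" by (simp add: z algebra_simps)
      also have "\<dots> \<le> q (x - J v) + q (y - J w)"
        by (intro sub subspace_diff[OF E] xy J v w)
      finally show ?thesis by (simp add: z)
    qed
    have "?h (x + y) - (q (x - J v) + u v) \<le> ?h y" if v: "v \<in> V" for v
      using *[OF v] by (intro cINF_greatest[OF \<open>V \<noteq> {}\<close>]) (simp add: algebra_simps)
    then have "?h (x + y) - ?h y \<le> ?h x"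
      by (intro cINF_greatest[OF \<open>V \<noteq> {}\<close>]) (simp add: algebra_simps)
    then show "?h (x + y) \<le> ?h x + ?h y" by linarith
  next
    fix x and r :: real assume x: "x \<in> E" and r: "0 < r"
    have "?h (r *\<^sub>R x) / r \<le> q (x - J v) + u v" if v: "v \<in> V" for v
    proof -
      obtain z where z: "z \<in> V" "J z = r *\<^sub>R J v" "u z = r * u v" using scale[OF v r] by blast
      have "?h (r *\<^sub>R x) \<le> q (r *\<^sub>R x - J z) + u z"
        by (rule upper[OF subspace_scale[OF E x] z(1)])
      also have "q (r *\<^sub>R x - J z) = r * q (x - J v)"
        using sublinear_on_scale[OF E q subspace_diff[OF E x J[OF v]] r]
        by (simp add: z scaleR_right_diff_distrib)
      finally show ?thesis using r by (simp add: z field_simps)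
    qed
    then have "?h (r *\<^sub>R x) / r \<le> ?h x" by (intro cINF_greatest[OF \<open>V \<noteq> {}\<close>])
    then show "?h (r *\<^sub>R x) \<le> r * ?h x" using r by (simp add: field_simps)
  qed
qed

text \<open>Zorn's lemma on the sublinear functionals below \<open>p\<close>, with the order
  reversed so that a maximal element is a minimal functional.\<close>

lemma exists_minimal_sublinear:
  fixes p :: "'a::real_vector \<Rightarrow> real"
  assumes E: "subspace E" and p: "sublinear_on E p"
  obtains q where "sublinear_on E q" "\<And>x. x \<in> E \<Longrightarrow> q x \<le> p x"
    "\<And>h x. sublinear_on E h \<Longrightarrow> (\<And>x. x \<in> E \<Longrightarrow> h x \<le> q x) \<Longrightarrow> x \<in> E \<Longrightarrow> h x = q x"
proof -
  \<comment> \<open>Vanishing outside \<open>E\<close> reduces the comparison on the whole type in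
    \<open>R\<close> to the values on \<open>E\<close>, so the order is antisymmetric although
    sublinearity concerns only \<open>E\<close>.\<close>
  define A where "A = {q. sublinear_on E q \<and> (\<forall>x\<in>E. q x \<le> p x) \<and> (\<forall>x. x \<notin> E \<longrightarrow> q x = 0)}"
  define R where "R = (\<lambda>q h :: 'a \<Rightarrow> real. \<forall>x. h x \<le> q x)"
  have cut: "sublinear_on E (\<lambda>x. if x \<in> E then h x else 0)" if "sublinear_on E h" for h
    using that E by (simp add: sublinear_on_def subspace_add subspace_scale)
  have "\<exists>m\<in>A. \<forall>a\<in>A. R m a \<longrightarrow> a = m"
  proof (rule predicate_Zorn)
    show "partial_order_on A (relation_of R A)"
      unfolding R_def by (rule partial_order_on_relation_ofI) (auto intro: order_trans intro!: ext order_antisym)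
  next
    fix C assume C: "C \<in> Chains (relation_of R A)"
    then have CA: "C \<subseteq> A" and chain: "\<And>a b. a \<in> C \<Longrightarrow> b \<in> C \<Longrightarrow> R a b \<or> R b a"
      by (auto simp: Chains_def relation_of_def)
    show "\<exists>h\<in>A. \<forall>q\<in>C. R q h"
    proof (cases "C = {}")
      case True
      then show ?thesis using cut[OF p]
        by (intro bexI[of _ "\<lambda>x. if x \<in> E then p x else 0"]) (auto simp: A_def)
    next
      case False
      define h where "h = (\<lambda>x. INF q\<in>C. q x)"
      have bdd: "bdd_below ((\<lambda>q. q x) ` C)" for x
      proof (rule bdd_belowI2)
        fix q assume "q \<in> C"
        then have q: "q \<in> A" using CA by auto
        show "(if x \<in> E then - p (- x) else 0) \<le> q x"
          using q sublinear_on_neg_lower[OF E, of q x] subspace_neg[OF E, of x] by (fastforce simp: A_def)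
      qed
      have upper: "h x \<le> q x" if "q \<in> C" for q x
        unfolding h_def by (rule cINF_lower[OF bdd that])
      have "sublinear_on E h"
        unfolding sublinear_on_def
      proof (intro conjI ballI allI impI)
        fix x y assume xy: "x \<in> E" "y \<in> E"
        \<comment> \<open>One of \<open>a\<close>, \<open>b\<close> lies below the other in the
          chain, and it serves as \<open>c\<close> for both arguments. This is why subadditivity
          survives the infimum.\<close>
        have *: "h (x + y) \<le> a x + b y" if ab: "a \<in> C" "b \<in> C" for a b
        proof -
          obtain c where c: "c \<in> C" "c x \<le> a x" "c y \<le> b y"
            using chain[OF ab] ab unfolding R_def by (metis order_refl)
          have "h (x + y) \<le> c (x + y)" by (rule upper[OF c(1)])
          also have "\<dots> \<le> c x + c y" using c(1) CA xy by (auto simp: A_def sublinear_on_def)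
          finally show ?thesis using c by linarith
        qed
        have "h (x + y) - a x \<le> (INF q\<in>C. q y)" if "a \<in> C" for a
          using *[OF that] by (intro cINF_greatest[OF False]) (simp add: algebra_simps)
        then have "h (x + y) - h y \<le> (INF q\<in>C. q x)"
          by (intro cINF_greatest[OF False]) (simp add: algebra_simps h_def)
        then show "h (x + y) \<le> h x + h y" by (simp add: h_def)
      next
        fix x and r :: real assume x: "x \<in> E" and r: "0 < r"
        have "h (r *\<^sub>R x) / r \<le> a x" if a: "a \<in> C" for a
        proof -
          have "a (r *\<^sub>R x) \<le> r * a x" using a CA x r by (auto simp: A_def sublinear_on_def)
          with upper[OF a, of "r *\<^sub>R x"] have "h (r *\<^sub>R x) \<le> r * a x" by linarith
          then show ?thesis using r by (simp add: field_simps)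
        qed
        then have "h (r *\<^sub>R x) / r \<le> (INF q\<in>C. q x)" by (intro cINF_greatest[OF False])
        then show "h (r *\<^sub>R x) \<le> r * h x" using r by (simp add: h_def field_simps)
      qed
      moreover have "h x \<le> p x" if "x \<in> E" for x
      proof -
        obtain q where q: "q \<in> C" using False by blast
        then have "q x \<le> p x" using CA that by (auto simp: A_def)
        with upper[OF q, of x] show ?thesis by linarith
      qed
      moreover have "h x = 0" if "x \<notin> E" for x
      proof -
        have "(\<lambda>q. q x) ` C = {0}" using CA that False by (force simp: A_def)
        then show ?thesis by (simp add: h_def)
      qed
      ultimately show ?thesis using upper by (intro bexI[of _ h]) (auto simp: A_def R_def)
    qed
  qed
  then obtain q where q: "q \<in> A" and min: "\<And>a. a \<in> A \<Longrightarrow> R q a \<Longrightarrow> a = q" by blast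
  show thesis
  proof (rule that[of q])
    fix h x assume h: "sublinear_on E h" and le: "\<And>x. x \<in> E \<Longrightarrow> h x \<le> q x" and x: "x \<in> E"
    have "(\<lambda>x. if x \<in> E then h x else 0) = q"
      using q le by (intro min) (force simp: A_def R_def intro: cut[OF h])+
    from fun_cong[OF this, of x] x show "h x = q x" by simp
  qed (use q in \<open>auto simp: A_def\<close>)
qed

text \<open>If \<open>q\<close> is minimal, lowering it along a half-line through \<open>y\<close> changes nothing, which
  yields \<open>q x + q y \<le> q (x + y)\<close>.\<close>

lemma hahn_banach_pullback:
  fixes p :: "'a::real_vector \<Rightarrow> real" and J :: "'v \<Rightarrow> 'a"
  assumes E: "subspace E" and p: "sublinear_on E p" and "V \<noteq> {}"
    and J: "\<And>v. v \<in> V \<Longrightarrow> J v \<in> E"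
    and add: "\<And>v w. v \<in> V \<Longrightarrow> w \<in> V \<Longrightarrow> \<exists>z\<in>V. J z = J v + J w \<and> u z = u v + u w"
    and scale: "\<And>v r. v \<in> V \<Longrightarrow> \<exists>z\<in>V. J z = r *\<^sub>R J v \<and> u z = r * u v"
    and le: "\<And>v. v \<in> V \<Longrightarrow> u v \<le> p (J v)"
  obtains f where "\<And>x y. x \<in> E \<Longrightarrow> y \<in> E \<Longrightarrow> f (x + y) = f x + f y"
    "\<And>r x. x \<in> E \<Longrightarrow> f (r *\<^sub>R x) = r * f x"
    "\<And>x. x \<in> E \<Longrightarrow> f x \<le> p x" "\<And>v. v \<in> V \<Longrightarrow> f (J v) = u v"
proof -
  have neg: "\<exists>z\<in>V. J z = - J v \<and> u z = - u v" if "v \<in> V" for v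
    using scale[OF that, of "-1"] by simp
  have "- p (- J v) \<le> u v" if "v \<in> V" for v
    using neg[OF that] le by force
  note h = sublinear_on_inf_conv[OF E p \<open>V \<noteq> {}\<close> J add scale this]
  \<comment> \<open>A linear functional \<open>f \<le> h\<close> solves the problem: an index sent
    to 0 gives \<open>f \<le> p\<close>, and \<open>x = J v\<close> gives
    \<open>f (J v) \<le> u v\<close>, which becomes an equality on passing to the negative of
    \<open>v\<close>.\<close>
  define h where "h = (\<lambda>x. INF v\<in>V. p (x - J v) + u v)"
  have hs: "sublinear_on E h" and hu: "\<And>x v. x \<in> E \<Longrightarrow> v \<in> V \<Longrightarrow> h x \<le> p (x - J v) + u v"
    using h unfolding h_def by auto
  obtain q where q: "sublinear_on E q" "\<And>x. x \<in> E \<Longrightarrow> q x \<le> h x"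
    and min: "\<And>h x. sublinear_on E h \<Longrightarrow> (\<And>x. x \<in> E \<Longrightarrow> h x \<le> q x) \<Longrightarrow> x \<in> E \<Longrightarrow> h x = q x"
    using exists_minimal_sublinear[OF E hs] by blast
  have sup: "q x + q y \<le> q (x + y)" if x: "x \<in> E" and y: "y \<in> E" for x y
  proof -
    define k where "k = (\<lambda>x. INF t\<in>{0..}. q (x - t *\<^sub>R (- y)) + (- (t * q y)))"
    have *: "- q (- (t *\<^sub>R - y)) \<le> - (t * q y)" if "t \<in> {0..}" for t
      using sublinear_on_scale[OF E q(1) y, of t] sublinear_on_zero[OF E q(1)] that
      by (cases "t = 0") auto
    have k1: "sublinear_on E k" unfolding k_def
    proof (rule sublinear_on_inf_conv(1)[OF E q(1)])
      show "\<exists>z\<in>{0..}. z *\<^sub>R - y = v *\<^sub>R - y + w *\<^sub>R - y \<and> - (z * q y) = - (v * q y) + - (w * q y)"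
        if "v \<in> {0..}" "w \<in> {0..}" for v w :: real
        using that by (intro bexI[of _ "v + w"]) (auto simp: algebra_simps)
      show "\<exists>z\<in>{0..}. z *\<^sub>R - y = r *\<^sub>R v *\<^sub>R - y \<and> - (z * q y) = r * - (v * q y)"
        if "v \<in> {0..}" "0 < r" for v r :: real
        using that by (intro bexI[of _ "r * v"]) (auto simp: algebra_simps)
    qed (use * E y in \<open>auto intro!: subspace_neg subspace_scale\<close>)
    have k2: "k x \<le> q (x - t *\<^sub>R (- y)) + (- (t * q y))" if "x \<in> E" "t \<in> {0..}" for x t
      unfolding k_def
    proof (rule sublinear_on_inf_conv(2)[OF E q(1)])
      show "\<exists>z\<in>{0..}. z *\<^sub>R - y = v *\<^sub>R - y + w *\<^sub>R - y \<and> - (z * q y) = - (v * q y) + - (w * q y)"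
        if "v \<in> {0..}" "w \<in> {0..}" for v w :: real
        using that by (intro bexI[of _ "v + w"]) (auto simp: algebra_simps)
      show "\<exists>z\<in>{0..}. z *\<^sub>R - y = r *\<^sub>R v *\<^sub>R - y \<and> - (z * q y) = r * - (v * q y)"
        if "v \<in> {0..}" "0 < r" for v r :: real
        using that by (intro bexI[of _ "r * v"]) (auto simp: algebra_simps)
    qed (use * E y that in \<open>auto intro!: subspace_neg subspace_scale\<close>)
    \<comment> \<open>\<open>t = 0\<close> gives \<open>k \<le> q\<close>, hence equality by
      minimality; \<open>t = 1\<close> then reads \<open>q x \<le> q (x + y) - q y\<close>.\<close>
    have "k x = q x"
      using k2[of _ 0] by (intro min[OF k1 _ x]) auto
    then show ?thesis using k2[OF x, of 1] by simp
  qed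
  have fadd: "q (x + y) = q x + q y" if "x \<in> E" "y \<in> E" for x y
    using sup[OF that] q(1) that by (force simp: sublinear_on_def)
  have q0: "q 0 = 0" by (rule sublinear_on_zero[OF E q(1)])
  have fneg: "q (- x) = - q x" if "x \<in> E" for x
    using fadd[OF that subspace_neg[OF E that]] q0 by simp
  have fscale: "q (r *\<^sub>R x) = r * q x" if x: "x \<in> E" for r x
  proof (cases r "0 :: real" rule: linorder_cases)
    case less
    then show ?thesis
      using sublinear_on_scale[OF E q(1) x, of "- r"] fneg[OF subspace_scale[OF E x], of r] by simp
  qed (use q0 sublinear_on_scale[OF E q(1) x] in auto)
  have p0: "p 0 = 0" by (rule sublinear_on_zero[OF E p])
  have qu: "q (J v) \<le> u v" if "v \<in> V" for v
    using q(2)[OF J[OF that]] hu[OF J[OF that] that] p0 by simp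
  show thesis
  proof (rule that[of q])
    fix x assume x: "x \<in> E"
    obtain v where "v \<in> V" using \<open>V \<noteq> {}\<close> by blast
    \<comment> \<open>\<open>V\<close> has no zero of its own; scaling any index by 0 provides
      one.\<close>
    then obtain z where z: "z \<in> V" "J z = 0" "u z = 0" using scale[of v 0] by auto
    show "q x \<le> p x" using q(2)[OF x] hu[OF x z(1)] z by simp
  next
    fix v assume v: "v \<in> V"
    obtain z where z: "z \<in> V" "J z = - J v" "u z = - u v" using neg[OF v] by blast
    show "q (J v) = u v"
      using qu[OF v] qu[OF z(1)] fneg[OF J[OF v]] z by simp
  qed (use fadd fscale in auto)
qed

section \<open>Topologies generated by seminorms\<close>

definition function_space :: "('i \<Rightarrow> complex) set \<Rightarrow> bool" where
  "function_space V \<longleftrightarrow> (\<lambda>i. 0) \<in> V \<and>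
     (\<forall>f\<in>V. \<forall>g\<in>V. (\<lambda>i. f i + g i) \<in> V) \<and> (\<forall>f\<in>V. \<forall>a. (\<lambda>i. a * f i) \<in> V)"

lemma function_space_zero: "function_space V \<Longrightarrow> (\<lambda>i. 0) \<in> V"
  by (simp add: function_space_def)

lemma function_space_add:
  "function_space V \<Longrightarrow> f \<in> V \<Longrightarrow> g \<in> V \<Longrightarrow> (\<lambda>i. f i + g i) \<in> V"
  by (simp add: function_space_def)

lemma function_space_scale: "function_space V \<Longrightarrow> f \<in> V \<Longrightarrow> (\<lambda>i. a * f i) \<in> V"
  by (simp add: function_space_def)

lemma function_space_diff:
  assumes "function_space V" "f \<in> V" "g \<in> V"
  shows "(\<lambda>i. f i - g i) \<in> V"
  using function_space_add[OF assms(1,2) function_space_scale[OF assms(1,3), of "-1"]] by simp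

lemma linear_functional_on_add:
  "linear_functional_on V \<phi> \<Longrightarrow> f \<in> V \<Longrightarrow> g \<in> V \<Longrightarrow> \<phi> (\<lambda>i. f i + g i) = \<phi> f + \<phi> g"
  by (simp add: linear_functional_on_def)

lemma linear_functional_on_scale:
  "linear_functional_on V \<phi> \<Longrightarrow> f \<in> V \<Longrightarrow> \<phi> (\<lambda>i. a * f i) = a * \<phi> f"
  by (simp add: linear_functional_on_def)

lemma linear_functional_on_diff:
  assumes "function_space V" "linear_functional_on V \<phi>" "f \<in> V" "g \<in> V"
  shows "\<phi> (\<lambda>i. f i - g i) = \<phi> f - \<phi> g"
  using linear_functional_on_add[OF assms(2,3) function_space_scale[OF assms(1,4), of "-1"]]
    linear_functional_on_scale[OF assms(2,4), of "-1"] by simp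

lemma linear_functional_on_zero:
  assumes "function_space V" "linear_functional_on V \<phi>"
  shows "\<phi> (\<lambda>i. 0) = 0"
  using linear_functional_on_scale[OF assms(2) function_space_zero[OF assms(1)], of 0] by simp

lemma seminorm_on_nonneg: "seminorm_on V p \<Longrightarrow> f \<in> V \<Longrightarrow> 0 \<le> p f"
  by (simp add: seminorm_on_def)

lemma seminorm_on_triangle:
  "seminorm_on V p \<Longrightarrow> f \<in> V \<Longrightarrow> g \<in> V \<Longrightarrow> p (\<lambda>i. f i + g i) \<le> p f + p g"
  by (simp add: seminorm_on_def)

lemma seminorm_on_scale:
  "seminorm_on V p \<Longrightarrow> f \<in> V \<Longrightarrow> p (\<lambda>i. a * f i) = cmod a * p f"
  by (simp add: seminorm_on_def)

lemma seminorm_on_zero: "function_space V \<Longrightarrow> seminorm_on V p \<Longrightarrow> p (\<lambda>i. 0) = 0"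
  using seminorm_on_scale[of V p "\<lambda>i. 0" 0] function_space_zero[of V] by simp

lemma seminorm_on_commute:
  assumes "function_space V" "seminorm_on V p" "f \<in> V" "g \<in> V"
  shows "p (\<lambda>i. f i - g i) = p (\<lambda>i. g i - f i)"
  using seminorm_on_scale[OF assms(2) function_space_diff[OF assms(1,3,4)], of "-1"] by simp

lemma seminorm_on_triangle_sub:
  assumes "function_space V" "seminorm_on V p" "f \<in> V" "g \<in> V"
  shows "p f \<le> p (\<lambda>i. f i - g i) + p g"
  using seminorm_on_triangle[OF assms(2) function_space_diff[OF assms(1,3,4)] assms(4)] by simp

lemma seminorm_on_reverse_triangle:
  assumes "function_space V" "seminorm_on V p" "f \<in> V" "g \<in> V"
  shows "\<bar>p f - p g\<bar> \<le> p (\<lambda>i. f i - g i)"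
  using seminorm_on_triangle_sub[OF assms] seminorm_on_triangle_sub[OF assms(1,2,4,3)]
    seminorm_on_commute[OF assms] by linarith

lemma seminorm_on_linear_functional:
  assumes "linear_functional_on V \<phi>"
  shows "seminorm_on V (\<lambda>f. cmod (\<phi> f))"
  using assms by (auto simp: seminorm_on_def linear_functional_on_def norm_triangle_ineq norm_mult)

lemma seminorm_on_compose:
  assumes "seminorm_on W p" "\<And>f. f \<in> V \<Longrightarrow> L f \<in> W"
    "\<And>f g. f \<in> V \<Longrightarrow> g \<in> V \<Longrightarrow> L (\<lambda>i. f i + g i) = (\<lambda>j. L f j + L g j)"
    "\<And>f a. f \<in> V \<Longrightarrow> L (\<lambda>i. a * f i) = (\<lambda>j. a * L f j)"
  shows "seminorm_on V (\<lambda>f. p (L f))"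
  using assms by (simp add: seminorm_on_def)

section \<open>Neighbourhoods and continuity in seminorm topologies\<close>

lemma openin_seminorm_ball:
  "p \<in> P \<Longrightarrow> x \<in> V \<Longrightarrow> 0 < e \<Longrightarrow> openin (seminorm_topology V P) {y \<in> V. p (\<lambda>i. y i - x i) < e}"
  unfolding seminorm_topology_def by (rule topology_generated_by_Basis) auto

lemma continuous_map_into_seminorm_topology:
  assumes "\<And>z. z \<in> topspace X \<Longrightarrow> g z \<in> V"
    and "\<And>p x e. p \<in> P \<Longrightarrow> x \<in> V \<Longrightarrow> 0 < e \<Longrightarrow>
           openin X {z \<in> topspace X. p (\<lambda>i. g z i - x i) < e}"
  shows "continuous_map X (seminorm_topology V P) g"
  unfolding seminorm_topology_def
proof (rule continuous_on_generated_topo)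
  fix U assume U: "U \<in> insert V {{y \<in> V. p (\<lambda>i. y i - x i) < e} |p x e. p \<in> P \<and> x \<in> V \<and> 0 < e}"
  show "openin X (g -` U \<inter> topspace X)"
  proof (cases "U = V")
    case True
    then have "g -` U \<inter> topspace X = topspace X" using assms(1) by auto
    then show ?thesis by simp
  next
    case False
    then obtain p x e where *: "U = {y \<in> V. p (\<lambda>i. y i - x i) < e}" "p \<in> P" "x \<in> V" "0 < e"
      using U by auto
    then have "g -` U \<inter> topspace X = {z \<in> topspace X. p (\<lambda>i. g z i - x i) < e}"
      using assms(1) by auto
    then show ?thesis using assms(2) * by simp
  qed
qed (use assms(1) in auto)

lemma continuous_map_into_seminorm_topology_real:
  assumes "\<And>z. z \<in> topspace X \<Longrightarrow> g z \<in> V"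
    and "\<And>p x. p \<in> P \<Longrightarrow> x \<in> V \<Longrightarrow> continuous_map X euclidean (\<lambda>z. p (\<lambda>i. g z i - x i) :: real)"
  shows "continuous_map X (seminorm_topology V P) g"
proof (rule continuous_map_into_seminorm_topology[OF assms(1)])
  fix p x and e :: real assume "p \<in> P" "x \<in> V"
  from openin_continuous_map_preimage[OF assms(2)[OF this], of "{..<e}"]
  show "openin X {z \<in> topspace X. p (\<lambda>i. g z i - x i) < e}"
    by simp
qed

text \<open>Subbasic balls may be centred anywhere. By the triangle inequality the ball of radius
  \<open>e\<close> around \<open>z\<close> contains the one of radius
  \<open>e - p (\<lambda>i. x i - z i)\<close> around \<open>x\<close>; finite intersections account
  for the finite set \<open>F\<close>.\<close>

lemma seminorm_topology_neighbourhood: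
  assumes V: "function_space V" and P: "\<And>p. p \<in> P \<Longrightarrow> seminorm_on V p"
    and "openin (seminorm_topology V P) U" "x \<in> U"
  shows "\<exists>F e. finite F \<and> F \<subseteq> P \<and> 0 < e \<and> {y \<in> V. \<forall>p\<in>F. p (\<lambda>i. y i - x i) < e} \<subseteq> U"
proof -
  have "generate_topology_on
    (insert V {{y \<in> V. p (\<lambda>i. y i - x i) < e} |p x e. p \<in> P \<and> x \<in> V \<and> 0 < e}) U"
    using assms(3) unfolding seminorm_topology_def by (rule openin_topology_generated_by)
  then show ?thesis using \<open>x \<in> U\<close>
  proof (induction rule: generate_topology_on.induct)
    case (Int a b)
    have "x \<in> a" "x \<in> b" using Int.prems by auto
    obtain F e where 1: "finite F" "F \<subseteq> P" "0 < e" "{y \<in> V. \<forall>p\<in>F. p (\<lambda>i. y i - x i) < e} \<subseteq> a"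
      using Int.IH(1)[OF \<open>x \<in> a\<close>] by (elim exE conjE) rule
    obtain F' e' where 2: "finite F'" "F' \<subseteq> P" "0 < e'" "{y \<in> V. \<forall>p\<in>F'. p (\<lambda>i. y i - x i) < e'} \<subseteq> b"
      using Int.IH(2)[OF \<open>x \<in> b\<close>] by (elim exE conjE) rule
    have "{y \<in> V. \<forall>p\<in>F \<union> F'. p (\<lambda>i. y i - x i) < min e e'} \<subseteq> a \<inter> b"
      using 1(4) 2(4) by auto
    with 1 2 show ?case
      by (intro exI[of _ "F \<union> F'"] exI[of _ "min e e'"] conjI) simp_all
  next
    case (UN K)
    then obtain k where k: "k \<in> K" "x \<in> k" by auto
    then have "k \<subseteq> \<Union>K" by auto
    with UN.IH[OF k] show ?case by (elim exE conjE) (intro exI conjI, assumption+, rule subset_trans)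
  next
    case (Basis s)
    then consider "s = V" | p z e where "s = {y \<in> V. p (\<lambda>i. y i - z i) < e}" "p \<in> P" "z \<in> V" "0 < e"
      by auto
    then show ?case
    proof cases
      case 1
      then show ?thesis by (intro exI[of _ "{}"] exI[of _ 1]) simp
    next
      case 2
      have "p (\<lambda>i. y i - z i) < e" if y: "y \<in> V" "p (\<lambda>i. y i - x i) < e - p (\<lambda>i. x i - z i)" for y
      proof -
        have "x \<in> V" using 2 Basis by auto
        then have "p (\<lambda>i. (y i - x i) + (x i - z i)) \<le> p (\<lambda>i. y i - x i) + p (\<lambda>i. x i - z i)"
          using seminorm_on_triangle[OF P[OF 2(2)]] function_space_diff[OF V] y(1) 2(3) by blast
        then show ?thesis using y(2) by simp
      qed
      then have "{y \<in> V. \<forall>p\<in>{p}. p (\<lambda>i. y i - x i) < e - p (\<lambda>i. x i - z i)} \<subseteq> s"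
        by (auto simp: 2)
      moreover have "0 < e - p (\<lambda>i. x i - z i)" using Basis 2 by simp
      ultimately show ?thesis using 2(2)
        by (intro exI[of _ "{p}"] exI[of _ "e - p (\<lambda>i. x i - z i)"] conjI) simp_all
    qed
  qed simp
qed

lemma continuous_map_seminorm_topology_Lipschitz:
  fixes \<phi> :: "('i \<Rightarrow> complex) \<Rightarrow> 'b::metric_space"
  assumes V: "function_space V" and "p \<in> P" "seminorm_on V p"
    and L: "\<And>x y. x \<in> V \<Longrightarrow> y \<in> V \<Longrightarrow> dist (\<phi> y) (\<phi> x) \<le> C * p (\<lambda>i. y i - x i)"
  shows "continuous_map (seminorm_topology V P) euclidean \<phi>"
  unfolding continuous_map_def
proof (intro conjI allI impI)
  fix U :: "'b set" assume U: "openin euclidean U"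
  show "openin (seminorm_topology V P) {x \<in> topspace (seminorm_topology V P). \<phi> x \<in> U}"
  proof (rule openin_subopen[THEN iffD2], intro ballI)
    fix x assume "x \<in> {x \<in> topspace (seminorm_topology V P). \<phi> x \<in> U}"
    then have x: "x \<in> V" "\<phi> x \<in> U" by auto
    then obtain e where e: "0 < e" "\<And>z. dist z (\<phi> x) < e \<Longrightarrow> z \<in> U"
      using U by (auto simp: open_dist)
    \<comment> \<open>\<open>C\<close> comes without a sign, so \<open>\<bar>C\<bar> + 1\<close> is
      taken as a positive divisor.\<close>
    define d where "d = e / (\<bar>C\<bar> + 1)"
    have d: "0 < d" using e by (simp add: d_def)
    have "\<phi> y \<in> U" if y: "y \<in> V" "p (\<lambda>i. y i - x i) < d" for y
    proof (rule e(2))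
      have nn: "0 \<le> p (\<lambda>i. y i - x i)"
        using seminorm_on_nonneg[OF assms(3)] function_space_diff[OF V y(1) x(1)] by blast
      have "dist (\<phi> y) (\<phi> x) \<le> C * p (\<lambda>i. y i - x i)" by (rule L[OF x(1) y(1)])
      also have "\<dots> \<le> (\<bar>C\<bar> + 1) * p (\<lambda>i. y i - x i)" using nn by (intro mult_right_mono) auto
      also have "\<dots> < (\<bar>C\<bar> + 1) * d" using y(2) by (intro mult_strict_left_mono) auto
      also have "\<dots> = e" by (simp add: d_def)
      finally show "dist (\<phi> y) (\<phi> x) < e" .
    qed
    moreover have "p (\<lambda>i. x i - x i) < d"
      using seminorm_on_zero[OF V assms(3)] d by simp
    ultimately show "\<exists>T. openin (seminorm_topology V P) T \<and> x \<in> T \<and> T \<subseteq> {x \<in> topspace (seminorm_topology V P). \<phi> x \<in> U}"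
      using openin_seminorm_ball[OF assms(2) x(1) d] x(1)
      by (intro exI[of _ "{y \<in> V. p (\<lambda>i. y i - x i) < d}"]) auto
  qed
qed auto

lemma linear_functional_on_bounded_dual:
  assumes V: "function_space V" and "p \<in> P" "seminorm_on V p"
    and "linear_functional_on V \<phi>" "\<And>x. x \<in> V \<Longrightarrow> cmod (\<phi> x) \<le> C * p x"
  shows "\<phi> \<in> dual (seminorm_topology V P)"
proof -
  have "continuous_map (seminorm_topology V P) euclidean \<phi>"
  proof (rule continuous_map_seminorm_topology_Lipschitz[OF assms(1-3)])
    fix x y assume xy: "x \<in> V" "y \<in> V"
    show "dist (\<phi> y) (\<phi> x) \<le> C * p (\<lambda>i. y i - x i)"
      using assms(5)[OF function_space_diff[OF V xy(2,1)]]
        linear_functional_on_diff[OF V assms(4) xy(2,1)]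
      by (simp add: dist_norm)
  qed
  with assms(4) show ?thesis by (simp add: dual_def)
qed

lemma continuous_map_seminorm_topologies_linear:
  assumes V: "function_space V" and W: "function_space W"
    and Q: "\<And>q. q \<in> Q \<Longrightarrow> seminorm_on W q"
    and L: "\<And>f. f \<in> V \<Longrightarrow> L f \<in> W"
    and diff: "\<And>f g. f \<in> V \<Longrightarrow> g \<in> V \<Longrightarrow> L (\<lambda>i. f i - g i) = (\<lambda>j. L f j - L g j)"
    and P: "\<And>q. q \<in> Q \<Longrightarrow> \<exists>p\<in>P. seminorm_on V p \<and> (\<forall>f\<in>V. q (L f) \<le> p f)"
  shows "continuous_map (seminorm_topology V P) (seminorm_topology W Q) L"
proof (rule continuous_map_into_seminorm_topology_real)
  fix q w assume q: "q \<in> Q" and w: "w \<in> W"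
  obtain p where p: "p \<in> P" "seminorm_on V p" "\<And>f. f \<in> V \<Longrightarrow> q (L f) \<le> p f"
    using P[OF q] by blast
  show "continuous_map (seminorm_topology V P) euclidean (\<lambda>z. q (\<lambda>i. L z i - w i))"
  proof (rule continuous_map_seminorm_topology_Lipschitz[OF V p(1,2), of _ 1])
    fix x y assume xy: "x \<in> V" "y \<in> V"
    have "\<bar>q (\<lambda>i. L y i - w i) - q (\<lambda>i. L x i - w i)\<bar> \<le> q (\<lambda>i. (L y i - w i) - (L x i - w i))"
      by (intro seminorm_on_reverse_triangle[OF W Q[OF q]] function_space_diff[OF W] L xy w)
    also have "\<dots> = q (L (\<lambda>i. y i - x i))" using diff[OF xy(2,1)] by simp
    also have "\<dots> \<le> p (\<lambda>i. y i - x i)" by (intro p(3) function_space_diff[OF V] xy)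
    finally show "dist (q (\<lambda>i. L y i - w i)) (q (\<lambda>i. L x i - w i)) \<le> 1 * p (\<lambda>i. y i - x i)"
      by (simp add: dist_real_def)
  qed
qed (use L in auto)

section \<open>The weak topology as the initial topology for the dual\<close>

lemma topspace_weak_topology [simp]: "topspace (weak_topology X) = topspace X"
  by (simp add: weak_topology_def)

text \<open>Linearity turns a weak seminorm centred at \<open>x\<close> into the distance of
  \<open>\<phi> (g z)\<close> from the constant \<open>\<phi> x\<close>.\<close>

lemma continuous_map_into_weak_topology:
  assumes V: "function_space (topspace Y)"
    and g: "\<And>z. z \<in> topspace X \<Longrightarrow> g z \<in> topspace Y"
    and c: "\<And>\<phi>. \<phi> \<in> dual Y \<Longrightarrow> continuous_map X euclidean (\<lambda>z. \<phi> (g z))"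
  shows "continuous_map X (weak_topology Y) g"
  unfolding weak_topology_def
proof (rule continuous_map_into_seminorm_topology_real[OF g])
  fix p x assume "p \<in> {\<lambda>x. cmod (\<phi> x) |\<phi>. \<phi> \<in> dual Y}" and x: "x \<in> topspace Y"
  then obtain \<phi> where \<phi>: "p = (\<lambda>x. cmod (\<phi> x))" "\<phi> \<in> dual Y" by auto
  show "continuous_map X euclidean (\<lambda>z. p (\<lambda>i. g z i - x i))"
  proof (rule continuous_map_eq)
    show "continuous_map X euclidean (\<lambda>z. cmod (\<phi> (g z) - \<phi> x))"
      by (intro continuous_intros c \<phi>)
  qed (use linear_functional_on_diff[OF V _ g x, of \<phi>] \<phi> in \<open>simp add: dual_def\<close>)
qed

lemma continuous_map_weak_topology_dual:
  assumes V: "function_space (topspace Y)" and \<phi>: "\<phi> \<in> dual Y"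
  shows "continuous_map (weak_topology Y) euclidean \<phi>"
  unfolding weak_topology_def
proof (rule continuous_map_seminorm_topology_Lipschitz[OF V, of "\<lambda>x. cmod (\<phi> x)" _ _ 1])
  show "(\<lambda>x. cmod (\<phi> x)) \<in> {\<lambda>x. cmod (\<phi> x) |\<phi>. \<phi> \<in> dual Y}"
    using \<phi> by blast
  show "seminorm_on (topspace Y) (\<lambda>x. cmod (\<phi> x))"
    using \<phi> by (auto simp: dual_def intro: seminorm_on_linear_functional)
  fix x y assume "x \<in> topspace Y" "y \<in> topspace Y"
  then show "dist (\<phi> y) (\<phi> x) \<le> 1 * cmod (\<phi> (\<lambda>i. y i - x i))"
    using linear_functional_on_diff[OF V, of \<phi> y x] \<phi> by (simp add: dual_def dist_norm)
qed

text \<open>Scaling a vector until it enters a basic neighbourhood of \<open>0\<close> turns continuity into boundedness.\<close>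

lemma dual_seminorm_topology_bounded:
  assumes V: "function_space V" and P: "\<And>p. p \<in> P \<Longrightarrow> seminorm_on V p"
    and \<phi>: "\<phi> \<in> dual (seminorm_topology V P)"
  obtains F C where "finite F" "F \<subseteq> P" "0 \<le> C" "\<And>x. x \<in> V \<Longrightarrow> cmod (\<phi> x) \<le> C * (\<Sum>p\<in>F. p x)"
proof -
  have lin: "linear_functional_on V \<phi>" and cont: "continuous_map (seminorm_topology V P) euclidean \<phi>"
    using \<phi> by (auto simp: dual_def)
  have "openin (seminorm_topology V P) {x \<in> V. \<phi> x \<in> ball 0 1}"
    using openin_continuous_map_preimage[OF cont, of "ball 0 1"] by simp
  moreover have "(\<lambda>i. 0) \<in> {x \<in> V. \<phi> x \<in> ball 0 1}"
    using linear_functional_on_zero[OF V lin] function_space_zero[OF V] by simp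
  ultimately have "\<exists>F e. finite F \<and> F \<subseteq> P \<and> 0 < e \<and>
    {y \<in> V. \<forall>p\<in>F. p (\<lambda>i. y i - 0) < e} \<subseteq> {x \<in> V. \<phi> x \<in> ball 0 1}"
    by (intro seminorm_topology_neighbourhood[OF V P])
  then obtain F e where F: "finite F" "F \<subseteq> P" and e: "0 < e"
    and sub: "{y \<in> V. \<forall>p\<in>F. p (\<lambda>i. y i - 0) < e} \<subseteq> {x \<in> V. \<phi> x \<in> ball 0 1}"
    by (elim exE conjE) rule
  have "cmod (\<phi> x) \<le> 1 / e * (\<Sum>p\<in>F. p x)" if x: "x \<in> V" for x
  proof -
    have nn: "0 \<le> p x" if "p \<in> F" for p
      using seminorm_on_nonneg P F x that by blast
    define s where "s = (\<Sum>p\<in>F. p x)"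
    have s: "0 \<le> s" "\<And>p. p \<in> F \<Longrightarrow> p x \<le> s"
      using nn F(1) by (auto simp: s_def sum_nonneg intro: member_le_sum)
    \<comment> \<open>\<open>s\<close> may be 0, so the scaling factor is \<open>e / (s + d)\<close>
      with a positive slack \<open>d\<close> that is removed afterwards.\<close>
    have "e * cmod (\<phi> x) \<le> s + d" if d: "0 < d" for d
    proof -
      define y where "y = (\<lambda>i. of_real (e / (s + d)) * x i)"
      have pos: "0 < s + d" using s d by simp
      have "p y < e" if "p \<in> F" for p
      proof -
        have "p y = cmod (of_real (e / (s + d))) * p x"
          unfolding y_def using that F by (intro seminorm_on_scale[OF P x]) auto
        also have "cmod (of_real (e / (s + d))) = e / (s + d)"
          using pos e by (simp only: norm_of_real) simp
        also have "e / (s + d) * p x < e" using s(2)[OF that] pos e d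
          by (simp add: field_simps add_strict_increasing)
        finally show ?thesis .
      qed
      moreover have "y \<in> V" unfolding y_def by (rule function_space_scale[OF V x])
      ultimately have "cmod (\<phi> y) < 1" using sub by auto
      moreover have "\<phi> y = of_real (e / (s + d)) * \<phi> x"
        unfolding y_def by (rule linear_functional_on_scale[OF lin x])
      then have "cmod (\<phi> y) = e / (s + d) * cmod (\<phi> x)"
        using pos e by (simp only: norm_mult norm_of_real) simp
      ultimately show ?thesis using pos by (simp add: field_simps)
    qed
    then have "e * cmod (\<phi> x) \<le> s" by (rule field_le_epsilon)
    then show ?thesis using e by (simp add: field_simps s_def)
  qed
  then show thesis using that[OF F, of "1 / e"] e by auto
qed

section \<open>Splitting a functional along finitely many linear maps\<close>

instantiation "fun" :: (type, scaleR) scaleR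
begin

definition "r *\<^sub>R f = (\<lambda>x. r *\<^sub>R f x)"

instance ..

end

lemma scaleR_fun_apply [simp]: "(r *\<^sub>R f) x = r *\<^sub>R f x"
  by (simp add: scaleR_fun_def)

text \<open>Makes \<open>'c \<Rightarrow> 'b \<Rightarrow> complex\<close>, the ambient type of a
  finite power of a function space, an instance to which the Hahn-Banach theorem applies.\<close>

instance "fun" :: (type, real_vector) real_vector
  by standard (simp_all add: fun_eq_iff scaleR_add_right scaleR_add_left)

text \<open>The bound dominates the real part of \<open>\<phi>\<close> by a sublinear functional of
  the family \<open>L c x\<close>, so it extends to the whole finite power of \<open>W\<close>. The
  restrictions of the extension to the coordinates, made complex linear, are the
  \<open>\<psi> c\<close>.\<close>

lemma dual_decomposition:
  fixes L :: "'c \<Rightarrow> ('a \<Rightarrow> complex) \<Rightarrow> 'b \<Rightarrow> complex"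
  assumes V: "function_space V" and W: "function_space W" and n: "seminorm_on W n"
    and S: "finite S" and C: "0 \<le> C"
    and L: "\<And>c x. c \<in> S \<Longrightarrow> x \<in> V \<Longrightarrow> L c x \<in> W"
    and L_add: "\<And>c x y. c \<in> S \<Longrightarrow> x \<in> V \<Longrightarrow> y \<in> V \<Longrightarrow> L c (\<lambda>i. x i + y i) = (\<lambda>j. L c x j + L c y j)"
    and L_scale: "\<And>c x a. c \<in> S \<Longrightarrow> x \<in> V \<Longrightarrow> L c (\<lambda>i. a * x i) = (\<lambda>j. a * L c x j)"
    and \<phi>: "linear_functional_on V \<phi>"
    and bound: "\<And>x. x \<in> V \<Longrightarrow> cmod (\<phi> x) \<le> C * (\<Sum>c\<in>S. n (L c x))"
  shows "\<exists>\<psi>. (\<forall>c\<in>S. \<psi> c \<in> dual (seminorm_topology W {n})) \<and>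
    (\<forall>x\<in>V. \<phi> x = (\<Sum>c\<in>S. \<psi> c (L c x)))"
proof -
  \<comment> \<open>The power of \<open>W\<close> over \<open>S\<close>; families are set to zero
    outside \<open>S\<close> to obtain a subspace of a full function type.\<close>
  define E where "E = {h :: 'c \<Rightarrow> 'b \<Rightarrow> complex. (\<forall>c\<in>S. h c \<in> W) \<and> (\<forall>c. c \<notin> S \<longrightarrow> h c = (\<lambda>_. 0))}"
  define p where "p = (\<lambda>h :: 'c \<Rightarrow> 'b \<Rightarrow> complex. C * (\<Sum>c\<in>S. n (h c)))"
  define J where "J = (\<lambda>x c. if c \<in> S then L c x else (\<lambda>_. 0))"
  have scaleR: "r *\<^sub>R y = (\<lambda>j. of_real r * y j)" for r and y :: "'b \<Rightarrow> complex"
    by (simp add: fun_eq_iff scaleR_conv_of_real)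
  have W_add: "y + z \<in> W" if "y \<in> W" "z \<in> W" for y z
    using function_space_add[OF W that] by (simp add: plus_fun_def)
  have W_scale: "r *\<^sub>R y \<in> W" if "y \<in> W" for r y
    using function_space_scale[OF W that] by (simp add: scaleR)
  have W0: "(\<lambda>_. 0) \<in> W" by (rule function_space_zero[OF W])
  have n_add: "n (y + z) \<le> n y + n z" if "y \<in> W" "z \<in> W" for y z
    using seminorm_on_triangle[OF n that] by (simp add: plus_fun_def)
  have n_scale: "n (r *\<^sub>R y) = \<bar>r\<bar> * n y" if "y \<in> W" for r y
    using seminorm_on_scale[OF n that, of "of_real r"] by (simp add: scaleR)
  have n0: "n (\<lambda>_. 0) = 0" by (rule seminorm_on_zero[OF W n])
  have E: "subspace E"
    unfolding subspace_def E_def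
    using W0 by (auto simp: W_add W_scale zero_fun_def)
  have p_scale: "p (r *\<^sub>R h) = \<bar>r\<bar> * p h" if "h \<in> E" for r h
  proof -
    have "(\<Sum>c\<in>S. n ((r *\<^sub>R h) c)) = \<bar>r\<bar> * (\<Sum>c\<in>S. n (h c))"
      unfolding sum_distrib_left using that by (intro sum.cong refl) (simp add: E_def n_scale)
    then show ?thesis by (simp add: p_def mult.left_commute)
  qed
  have p_add: "p (h + k) \<le> p h + p k" if "h \<in> E" "k \<in> E" for h k
  proof -
    have "(\<Sum>c\<in>S. n ((h + k) c)) \<le> (\<Sum>c\<in>S. n (h c) + n (k c))"
      using that by (intro sum_mono) (simp add: E_def n_add)
    then show ?thesis
      using C by (simp add: p_def sum.distrib mult_left_mono flip: distrib_left)
  qed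
  have p: "sublinear_on E p"
    unfolding sublinear_on_def using p_add p_scale by simp
  have JE: "J x \<in> E" if "x \<in> V" for x
    using L that by (simp add: J_def E_def)
  obtain f where f_add: "\<And>x y. x \<in> E \<Longrightarrow> y \<in> E \<Longrightarrow> f (x + y) = f x + f y"
    and f_scale: "\<And>r x. x \<in> E \<Longrightarrow> f (r *\<^sub>R x) = r * f x"
    and f_le: "\<And>x. x \<in> E \<Longrightarrow> f x \<le> p x" and f_J: "\<And>x. x \<in> V \<Longrightarrow> f (J x) = Re (\<phi> x)"
  proof (rule hahn_banach_pullback[OF E p, of V J "\<lambda>x. Re (\<phi> x)"])
    show "V \<noteq> {}" using function_space_zero[OF V] by blast
    show "\<exists>z\<in>V. J z = J x + J y \<and> Re (\<phi> z) = Re (\<phi> x) + Re (\<phi> y)" if "x \<in> V" "y \<in> V" for x y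
      using that by (intro bexI[of _ "\<lambda>i. x i + y i"])
        (simp_all add: J_def fun_eq_iff L_add linear_functional_on_add[OF \<phi>] function_space_add[OF V])
    show "\<exists>z\<in>V. J z = r *\<^sub>R J x \<and> Re (\<phi> z) = r * Re (\<phi> x)" if "x \<in> V" for x r
      using that by (intro bexI[of _ "\<lambda>i. of_real r * x i"])
        (simp_all add: J_def fun_eq_iff L_scale linear_functional_on_scale[OF \<phi>]
          function_space_scale[OF V] scaleR_conv_of_real)
    show "Re (\<phi> x) \<le> p (J x)" if "x \<in> V" for x
      using bound[OF that] complex_Re_le_cmod[of "\<phi> x"] by (simp add: p_def J_def)
  qed (use JE in auto)
  \<comment> \<open>\<open>p\<close> is invariant under \<open>h \<mapsto> - h\<close>, so the
    one-sided bound is two-sided.\<close>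
  have f_abs: "\<bar>f h\<bar> \<le> p h" if "h \<in> E" for h
    using f_le[OF that] f_le[OF subspace_scale[OF E that, of "-1"]] f_scale[OF that, of "-1"]
      p_scale[OF that, of "-1"] by simp
  \<comment> \<open>The embedding of the coordinate \<open>c\<close> into the power.\<close>
  define slot where "slot = (\<lambda>(c :: 'c) (y :: 'b \<Rightarrow> complex) d. if d = c then y else (\<lambda>_. 0))"
  have slot_E: "slot c y \<in> E" if "c \<in> S" "y \<in> W" for c y
    using that W0 by (auto simp: slot_def E_def)
  define g where "g = (\<lambda>c y. f (slot c y))"
  have g_add: "g c (\<lambda>j. y j + z j) = g c y + g c z" if "c \<in> S" "y \<in> W" "z \<in> W" for c y z
  proof -
    have "slot c (\<lambda>j. y j + z j) = slot c y + slot c z" by (simp add: slot_def fun_eq_iff)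
    then show ?thesis using f_add[OF slot_E slot_E] that by (simp add: g_def)
  qed
  have g_scale: "g c (\<lambda>j. of_real r * y j) = r * g c y" if "c \<in> S" "y \<in> W" for c y r
  proof -
    have "slot c (\<lambda>j. of_real r * y j) = r *\<^sub>R slot c y"
      by (simp add: slot_def fun_eq_iff scaleR_conv_of_real)
    then show ?thesis using f_scale[OF slot_E] that by (simp add: g_def)
  qed
  have g_abs: "\<bar>g c y\<bar> \<le> C * n y" if "c \<in> S" "y \<in> W" for c y
  proof -
    have "(\<Sum>d\<in>S. n (slot c y d)) = (\<Sum>d\<in>S. if d = c then n y else 0)"
      by (intro sum.cong refl) (simp add: slot_def n0)
    then have "p (slot c y) = C * n y" using S that(1) by (simp add: p_def)
    then show ?thesis using f_abs[OF slot_E[OF that]] by (simp add: g_def)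
  qed
  have f_J_sum: "f (J x) = (\<Sum>c\<in>S. g c (L c x))" if x: "x \<in> V" for x
  proof -
    \<comment> \<open>Generalised to subsets \<open>F\<close> of \<open>S\<close> so that
      coordinates can be split off one at a time.\<close>
    have "f (\<lambda>c. if c \<in> F then L c x else (\<lambda>_. 0)) = (\<Sum>c\<in>F. g c (L c x))" if "F \<subseteq> S" for F
      using finite_subset[OF that S] that
    proof (induction F rule: finite_induct)
      case empty
      have "0 \<in> E" by (rule subspace_0[OF E])
      then have "f 0 = 0" using f_scale[of 0 0] by simp
      then show ?case by (simp add: zero_fun_def)
    next
      case (insert c F)
      have "(\<lambda>d. if d \<in> insert c F then L d x else (\<lambda>_. 0)) =
        slot c (L c x) + (\<lambda>d. if d \<in> F then L d x else (\<lambda>_. 0))"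
        using insert.hyps by (auto simp: slot_def fun_eq_iff)
      moreover have "(\<lambda>d. if d \<in> F then L d x else (\<lambda>_. 0)) \<in> E"
        using insert.prems L x W0 by (auto simp: E_def)
      ultimately show ?case
        using insert f_add[OF slot_E[OF _ L]] x by (simp add: g_def)
    qed
    then show ?thesis by (simp add: J_def)
  qed
  \<comment> \<open>The usual recovery of a complex linear functional from its real part,
    \<open>g y - \<i> g (\<i> y)\<close>.\<close>
  define \<psi> where "\<psi> = (\<lambda>c y. Complex (g c y) (- g c (\<lambda>j. \<i> * y j)))"
  have iW: "(\<lambda>j. \<i> * y j) \<in> W" if "y \<in> W" for y by (rule function_space_scale[OF W that])
  have "\<psi> c \<in> dual (seminorm_topology W {n})" if c: "c \<in> S" for c
  proof (rule linear_functional_on_bounded_dual[OF W _ n, of _ _ "2 * C"])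
    show "linear_functional_on W (\<psi> c)"
      unfolding linear_functional_on_def
    proof (intro conjI ballI allI)
      fix y z assume "y \<in> W" "z \<in> W"
      then show "\<psi> c (\<lambda>j. y j + z j) = \<psi> c y + \<psi> c z"
        using g_add[OF c] iW by (simp add: \<psi>_def complex_eq_iff distrib_left)
    next
      fix y a assume y: "y \<in> W"
      have g_complex: "g c (\<lambda>j. a * z j) = Re a * g c z + Im a * g c (\<lambda>j. \<i> * z j)" if z: "z \<in> W" for a z
      proof -
        have "(\<lambda>j. a * z j) = (\<lambda>j. of_real (Re a) * z j + of_real (Im a) * (\<i> * z j))"
          by (subst complex_eq[of a]) (simp add: algebra_simps)
        then show ?thesis
          using g_add[OF c function_space_scale[OF W z] function_space_scale[OF W iW[OF z]]]
            g_scale[OF c z] g_scale[OF c iW[OF z]] by simp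
      qed
      have "g c (\<lambda>j. \<i> * (a * y j)) = g c (\<lambda>j. (\<i> * a) * y j)" by (simp add: mult.assoc)
      also have "\<dots> = - Im a * g c y + Re a * g c (\<lambda>j. \<i> * y j)"
        using g_complex[OF y, of "\<i> * a"] by simp
      finally show "\<psi> c (\<lambda>j. a * y j) = a * \<psi> c y"
        using g_complex[OF y, of a] by (simp add: \<psi>_def complex_eq_iff algebra_simps)
    qed
    \<comment> \<open>The factor 2 results from bounding real and imaginary part separately;
      continuity needs only some finite constant.\<close>
    show "cmod (\<psi> c y) \<le> 2 * C * n y" if y: "y \<in> W" for y
    proof -
      have "cmod (\<psi> c y) \<le> \<bar>g c y\<bar> + \<bar>g c (\<lambda>j. \<i> * y j)\<bar>"
        using cmod_le[of "\<psi> c y"] by (simp add: \<psi>_def)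
      moreover have "n (\<lambda>j. \<i> * y j) = n y" using seminorm_on_scale[OF n y, of "\<i>"] by simp
      ultimately show ?thesis using g_abs[OF c y] g_abs[OF c iW[OF y]] by simp
    qed
  qed simp
  moreover have "\<phi> x = (\<Sum>c\<in>S. \<psi> c (L c x))" if x: "x \<in> V" for x
  proof (rule complex_eqI)
    show "Re (\<phi> x) = Re (\<Sum>c\<in>S. \<psi> c (L c x))"
      using f_J[OF x] f_J_sum[OF x] by (simp add: \<psi>_def)
    \<comment> \<open>\<open>Re (\<phi> (\<i> x)) = - Im (\<phi> x)\<close>, so the identity of real
      parts at \<open>\<i> x\<close> yields that of imaginary parts.\<close>
    have "f (J (\<lambda>i. \<i> * x i)) = (\<Sum>c\<in>S. g c (\<lambda>j. \<i> * L c x j))"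
      unfolding f_J_sum[OF function_space_scale[OF V x]]
      using x by (intro sum.cong refl) (simp add: L_scale)
    then show "Im (\<phi> x) = Im (\<Sum>c\<in>S. \<psi> c (L c x))"
      using f_J[OF function_space_scale[OF V x, of "\<i>"]] linear_functional_on_scale[OF \<phi> x, of "\<i>"]
      by (simp add: \<psi>_def sum_negf)
  qed
  ultimately show ?thesis by blast
qed

section \<open>Translation bounded measures\<close>

lemma supp_subset_closed:
  assumes "closed K" "\<And>x. x \<notin> K \<Longrightarrow> f x = 0"
  shows "supp f \<subseteq> K"
  unfolding supp_def using assms by (intro closure_minimal) auto

lemma not_in_supp: "x \<notin> supp f \<Longrightarrow> f x = 0"
  unfolding supp_def using closure_subset[of "{x. f x \<noteq> 0}"] by auto

text \<open>In a Hausdorff space the compact set \<open>K\<close> is closed, so vanishing outside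
  \<open>K\<close> also controls the closure taken in \<open>supp\<close>.\<close>

lemma Cc_inI:
  fixes f :: "'g::t2_space \<Rightarrow> complex"
  assumes "continuous_on UNIV f" "compact K" "\<And>x. x \<notin> K \<Longrightarrow> f x = 0"
  shows "f \<in> Cc_in K"
proof -
  have sub: "supp f \<subseteq> K" by (rule supp_subset_closed[OF compact_imp_closed[OF assms(2)] assms(3)])
  have "compact (K \<inter> supp f)"
    by (intro compact_Int_closed assms(2)) (simp add: supp_def)
  then show ?thesis using sub assms(1) by (simp add: Cc_in_def Cc_def Int_absorb1)
qed

lemma Cc_inD: "f \<in> Cc_in K \<Longrightarrow> x \<notin> K \<Longrightarrow> f x = 0"
  by (rule not_in_supp) (auto simp: Cc_in_def)

lemma Cc_in_subset_Cc: "f \<in> Cc_in K \<Longrightarrow> f \<in> Cc"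
  by (simp add: Cc_in_def)

lemma Cc_in_supp: "f \<in> Cc \<Longrightarrow> f \<in> Cc_in (supp f)"
  by (simp add: Cc_in_def)

lemma Cc_continuous: "f \<in> Cc \<Longrightarrow> continuous_on S f"
  by (auto simp: Cc_def intro: continuous_on_subset)

lemma Cc_compact_supp: "f \<in> Cc \<Longrightarrow> compact (supp f)"
  by (simp add: Cc_def)

lemma Cc_bounded:
  assumes "f \<in> Cc"
  shows "bounded (range f)"
proof -
  have "bounded (insert 0 (f ` supp f))"
    using assms by (intro compact_imp_bounded compact_insert compact_continuous_image Cc_continuous Cc_compact_supp)
  moreover have "range f \<subseteq> insert 0 (f ` supp f)" using not_in_supp by fastforce
  ultimately show ?thesis by (rule bounded_subset)
qed

lemma function_space_Cc: "function_space (Cc :: ('g::t2_space \<Rightarrow> complex) set)"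
  unfolding function_space_def
proof (intro conjI ballI allI)
  show "(\<lambda>i. 0) \<in> (Cc :: ('g \<Rightarrow> complex) set)"
    by (rule Cc_in_subset_Cc[of _ "{}"], rule Cc_inI) simp_all
next
  fix f g :: "'g \<Rightarrow> complex" assume f: "f \<in> Cc" and g: "g \<in> Cc"
  show "(\<lambda>i. f i + g i) \<in> Cc"
    by (rule Cc_in_subset_Cc[of _ "supp f \<union> supp g"], rule Cc_inI)
      (simp_all add: f g continuous_on_add Cc_continuous Cc_compact_supp compact_Un not_in_supp)
next
  fix f :: "'g \<Rightarrow> complex" and a assume f: "f \<in> Cc"
  show "(\<lambda>i. a * f i) \<in> Cc"
    by (rule Cc_in_subset_Cc[of _ "supp f"], rule Cc_inI)
      (simp_all add: f continuous_on_mult_left Cc_continuous Cc_compact_supp not_in_supp)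
qed

lemma function_space_Cc_in:
  assumes "compact K"
  shows "function_space (Cc_in K :: ('g::t2_space \<Rightarrow> complex) set)"
  unfolding function_space_def
proof (intro conjI ballI allI)
  fix f g :: "'g \<Rightarrow> complex" and a
  assume f: "f \<in> Cc_in K"
  then have "(\<lambda>i. a * f i) \<in> Cc" using function_space_scale[OF function_space_Cc] Cc_in_subset_Cc by blast
  then show "(\<lambda>i. a * f i) \<in> Cc_in K"
    using f assms by (intro Cc_inI Cc_continuous) (simp_all add: Cc_inD)
  assume g: "g \<in> Cc_in K"
  have "(\<lambda>i. f i + g i) \<in> Cc"
    using function_space_add[OF function_space_Cc] Cc_in_subset_Cc f g by blast
  then show "(\<lambda>i. f i + g i) \<in> Cc_in K"
    using f g assms by (intro Cc_inI Cc_continuous) (simp_all add: Cc_inD)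
qed (use assms in \<open>auto intro: Cc_inI\<close>)

section \<open>The sup norm and the space of bounded uniformly continuous functions\<close>

lemma sup_norm_upper: "bounded (range f) \<Longrightarrow> cmod (f x) \<le> sup_norm f"
  unfolding sup_norm_def
  by (rule cSUP_upper) (auto simp: bounded_iff intro: bdd_aboveI2)

lemma sup_norm_least: "(\<And>x. cmod (f x) \<le> C) \<Longrightarrow> sup_norm f \<le> C"
  unfolding sup_norm_def by (rule cSUP_least) auto

lemma sup_norm_nonneg: "bounded (range f) \<Longrightarrow> 0 \<le> sup_norm f"
  using order_trans[OF norm_ge_zero sup_norm_upper[of f undefined]] .

lemma bounded_range_add:
  fixes f g :: "'i \<Rightarrow> complex"
  assumes "bounded (range f)" "bounded (range g)"
  shows "bounded (range (\<lambda>i. f i + g i))"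
  by (rule boundedI[where B="sup_norm f + sup_norm g"])
    (auto intro!: norm_triangle_mono sup_norm_upper assms)

lemma bounded_range_scale:
  fixes f :: "'i \<Rightarrow> complex"
  assumes "bounded (range f)"
  shows "bounded (range (\<lambda>i. a * f i))"
  by (rule boundedI[where B="cmod a * sup_norm f"])
    (auto simp: norm_mult intro!: mult_left_mono sup_norm_upper assms)

lemma seminorm_on_sup_norm:
  assumes "\<And>f. f \<in> V \<Longrightarrow> bounded (range f)"
  shows "seminorm_on V sup_norm"
  unfolding seminorm_on_def
proof (intro conjI ballI allI)
  fix f g assume fg: "f \<in> V" "g \<in> V"
  show "sup_norm (\<lambda>i. f i + g i) \<le> sup_norm f + sup_norm g"
    by (intro sup_norm_least norm_triangle_mono sup_norm_upper assms fg)
next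
  fix f a assume f: "f \<in> V"
  show "sup_norm (\<lambda>i. a * f i) = cmod a * sup_norm f"
  proof (rule antisym)
    show "sup_norm (\<lambda>i. a * f i) \<le> cmod a * sup_norm f"
      by (intro sup_norm_least) (auto simp: norm_mult intro!: mult_left_mono sup_norm_upper assms f)
    show "cmod a * sup_norm f \<le> sup_norm (\<lambda>i. a * f i)"
    proof (cases "a = 0")
      case False
      have "sup_norm f \<le> sup_norm (\<lambda>i. a * f i) / cmod a"
      proof (rule sup_norm_least)
        fix x
        have "cmod (a * f x) \<le> sup_norm (\<lambda>i. a * f i)"
          by (rule sup_norm_upper[OF bounded_range_scale[OF assms[OF f]]])
        then show "cmod (f x) \<le> sup_norm (\<lambda>i. a * f i) / cmod a"
          using False by (simp add: norm_mult field_simps)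
      qed
      then show ?thesis using False by (simp add: field_simps)
    qed (simp add: sup_norm_def)
  qed
qed (simp add: sup_norm_nonneg assms)

lemma Cu_bounded: "f \<in> Cu \<Longrightarrow> bounded (range f)"
  by (simp add: Cu_def)

lemma seminorm_on_Cu_sup_norm: "seminorm_on Cu sup_norm"
  by (rule seminorm_on_sup_norm) (rule Cu_bounded)

lemma function_space_Cu: "function_space (Cu :: ('g::topological_ab_group_add \<Rightarrow> complex) set)"
  unfolding function_space_def
proof (intro conjI ballI allI)
  show "(\<lambda>i. 0) \<in> (Cu :: ('g \<Rightarrow> complex) set)"
    by (auto simp: Cu_def intro: exI[of _ UNIV])
next
  fix f g :: "'g \<Rightarrow> complex" assume fg: "f \<in> Cu" "g \<in> Cu"
  have "\<exists>U. open U \<and> 0 \<in> U \<and> (\<forall>x y. x - y \<in> U \<longrightarrow> dist (f x + g x) (f y + g y) < e)" if e: "0 < e" for e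
  proof -
    obtain U where U: "open U" "0 \<in> U" "\<And>x y. x - y \<in> U \<Longrightarrow> dist (f x) (f y) < e / 2"
      using fg(1) half_gt_zero[OF e] unfolding Cu_def by blast
    obtain W where W: "open W" "0 \<in> W" "\<And>x y. x - y \<in> W \<Longrightarrow> dist (g x) (g y) < e / 2"
      using fg(2) half_gt_zero[OF e] unfolding Cu_def by blast
    show ?thesis
    proof (intro exI[of _ "U \<inter> W"] conjI allI impI)
      fix x y assume "x - y \<in> U \<inter> W"
      then show "dist (f x + g x) (f y + g y) < e"
        using dist_triangle_add[of "f x" "g x" "f y" "g y"] U(3)[of x y] W(3)[of x y] by auto
    qed (use U W in auto)
  qed
  then show "(\<lambda>i. f i + g i) \<in> Cu"
    using fg by (simp add: Cu_def bounded_range_add)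
next
  fix f :: "'g \<Rightarrow> complex" and a assume f: "f \<in> Cu"
  have "\<exists>U. open U \<and> 0 \<in> U \<and> (\<forall>x y. x - y \<in> U \<longrightarrow> dist (a * f x) (a * f y) < e)" if "0 < e" for e
  proof -
    have "0 < e / (cmod a + 1)" using that by (simp add: add_nonneg_pos)
    then obtain U where U: "open U" "0 \<in> U" "\<And>x y. x - y \<in> U \<Longrightarrow> dist (f x) (f y) < e / (cmod a + 1)"
      using f unfolding Cu_def by blast
    have "dist (a * f x) (a * f y) < e" if "x - y \<in> U" for x y
    proof -
      have "dist (a * f x) (a * f y) = cmod a * dist (f x) (f y)"
        by (simp add: dist_norm norm_mult flip: right_diff_distrib)
      also have "\<dots> \<le> (cmod a + 1) * dist (f x) (f y)" by (intro mult_right_mono) auto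
      also have "\<dots> < (cmod a + 1) * (e / (cmod a + 1))"
        using U(3)[OF that] by (intro mult_strict_left_mono) (auto simp: add_nonneg_pos)
      also have "\<dots> = e" by (simp add: add_nonneg_eq_0_iff)
      finally show ?thesis .
    qed
    with U show ?thesis by blast
  qed
  then show "(\<lambda>i. a * f i) \<in> Cu"
    using f by (simp add: Cu_def bounded_range_scale)
qed

section \<open>Translation, reflection and uniform continuity of test functions\<close>

lemma Cc_translate:
  fixes f :: "'g::{topological_ab_group_add, t2_space} \<Rightarrow> complex"
  assumes "f \<in> Cc_in ((+) x ` K)" "compact K"
  shows "(\<lambda>s. f (t + s)) \<in> Cc_in ((+) (x - t) ` K)"
proof (rule Cc_inI)
  show "continuous_on UNIV (\<lambda>s. f (t + s))"
    by (rule continuous_on_compose2[OF Cc_continuous[OF Cc_in_subset_Cc[OF assms(1)], of UNIV]])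
      (auto intro: continuous_intros)
  show "compact ((+) (x - t) ` K)"
    by (intro compact_continuous_image continuous_intros assms)
  fix s assume s: "s \<notin> (+) (x - t) ` K"
  have "t + s \<notin> (+) x ` K"
  proof
    assume "t + s \<in> (+) x ` K"
    then obtain k where "k \<in> K" "t + s = x + k" by auto
    then have "s = (x - t) + k" by (simp add: algebra_simps)
    then show False using s \<open>k \<in> K\<close> by blast
  qed
  then show "f (t + s) = 0" by (rule Cc_inD[OF assms(1)])
qed

text \<open>The support is recorded as a translate of one compact set, the reflected support of
  \<open>c\<close>, so that bounds uniform over translates apply to \<open>conv c\<close> at every
  \<open>x\<close>.\<close>

lemma Cc_reflect:
  fixes c :: "'g::{topological_ab_group_add, t2_space} \<Rightarrow> complex"
  assumes "c \<in> Cc"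
  shows "(\<lambda>s. c (x - s)) \<in> Cc_in ((+) x ` uminus ` supp c)"
proof (rule Cc_inI)
  show "continuous_on UNIV (\<lambda>s. c (x - s))"
    by (rule continuous_on_compose2[OF Cc_continuous[OF assms, of UNIV]]) (auto intro: continuous_intros)
  show "compact ((+) x ` uminus ` supp c)"
    by (intro compact_continuous_image continuous_intros Cc_compact_supp assms)
  fix s assume s: "s \<notin> (+) x ` uminus ` supp c"
  have "x - s \<notin> supp c"
  proof
    assume "x - s \<in> supp c"
    then have "x + - (x - s) \<in> (+) x ` uminus ` supp c" by blast
    then show False using s by simp
  qed
  then show "c (x - s) = 0" by (rule not_in_supp)
qed

text \<open>The tube lemma around \<open>{0} \<times> supp c\<close> provides one neighbourhood of 0
  for the whole compact support. It is symmetrised because possibly only one of \<open>x\<close>,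
  \<open>y\<close> lies in the support; if neither does, both values are 0.\<close>

lemma Cc_uniformly_continuous:
  fixes c :: "'g::{topological_ab_group_add, t2_space} \<Rightarrow> complex"
  assumes c: "c \<in> Cc" and e: "0 < e"
  shows "\<exists>U. open U \<and> 0 \<in> U \<and> (\<forall>x y. x - y \<in> U \<longrightarrow> dist (c x) (c y) < e)"
proof -
  define W where "W = {z :: 'g \<times> 'g. dist (c (snd z + fst z)) (c (snd z)) < e}"
  have "continuous_on UNIV (\<lambda>z :: 'g \<times> 'g. c (snd z + fst z))" "continuous_on UNIV (\<lambda>z :: 'g \<times> 'g. c (snd z))"
    by (rule continuous_on_compose2[OF Cc_continuous[OF c, of UNIV]]; auto intro!: continuous_intros)+
  then have "open W"
    unfolding W_def by (intro open_Collect_less continuous_intros)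
  moreover have "{0} \<times> supp c \<subseteq> W" using e by (auto simp: W_def)
  ultimately have "\<exists>X. 0 \<in> X \<and> open X \<and> X \<times> supp c \<subseteq> W"
    by (rule Elementary_Topology.tube_lemma[OF Cc_compact_supp[OF c]])
  then obtain X where X: "0 \<in> X" "open X" "X \<times> supp c \<subseteq> W" by (elim exE conjE)
  have near: "dist (c x) (c y) < e" if "x - y \<in> X" "y \<in> supp c" for x y
  proof -
    have "(x - y, y) \<in> W" using that X(3) by auto
    then show ?thesis by (simp add: W_def)
  qed
  show ?thesis
  proof (intro exI[of _ "X \<inter> uminus -` X"] conjI allI impI)
    show "open (X \<inter> uminus -` X)"
      using X(2) by (intro open_Int open_vimage continuous_intros)
    fix x y assume "x - y \<in> X \<inter> uminus -` X"
    then have "x - y \<in> X" "y - x \<in> X" by auto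
    then show "dist (c x) (c y) < e"
      using near[of x y] near[of y x] not_in_supp[of x c] not_in_supp[of y c] e
      by (cases "x \<in> supp c"; cases "y \<in> supp c") (auto simp: dist_commute)
  qed (use X in auto)
qed

text \<open>Every translation bounded measure lies in some \<open>tb_ball C\<close>, and these sets are closed under
  translation and compact for pointwise convergence.\<close>

definition tb_ball :: "('g::topological_ab_group_add set \<Rightarrow> real) \<Rightarrow> 'g functional set" where
  "tb_ball C = {\<nu>. linear_functional_on Cc \<nu> \<and> (\<forall>f. f \<notin> Cc \<longrightarrow> \<nu> f = 0) \<and>
     (\<forall>K. compact K \<longrightarrow> (\<forall>x. \<forall>f\<in>Cc_in ((+) x ` K). cmod (\<nu> f) \<le> C K * sup_norm f))}"

lemma tb_ball_bound:
  "\<nu> \<in> tb_ball C \<Longrightarrow> compact K \<Longrightarrow> f \<in> Cc_in ((+) x ` K) \<Longrightarrow> cmod (\<nu> f) \<le> C K * sup_norm f"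
  by (simp add: tb_ball_def)

text \<open>\<open>C K\<close> has no prescribed sign; the absolute value allows the sup norm to be
  replaced by any upper bound \<open>B\<close>.\<close>

lemma tb_ball_bound_sup:
  assumes "\<nu> \<in> tb_ball C" "compact K" "f \<in> Cc_in ((+) x ` K)" "\<And>s. cmod (f s) \<le> B"
  shows "cmod (\<nu> f) \<le> \<bar>C K\<bar> * B"
proof -
  have "cmod (\<nu> f) \<le> C K * sup_norm f" by (rule tb_ball_bound[OF assms(1-3)])
  also have "\<dots> \<le> \<bar>C K\<bar> * sup_norm f"
    using sup_norm_nonneg[OF Cc_bounded[OF Cc_in_subset_Cc[OF assms(3)]]] by (intro mult_right_mono) auto
  also have "\<dots> \<le> \<bar>C K\<bar> * B" by (intro mult_left_mono sup_norm_least assms(4)) simp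
  finally show ?thesis .
qed

lemma tb_ball_bound_Cc:
  "\<nu> \<in> tb_ball C \<Longrightarrow> f \<in> Cc \<Longrightarrow> cmod (\<nu> f) \<le> C (supp f) * sup_norm f"
  using tb_ball_bound[of \<nu> C "supp f" f 0] by (simp add: Cc_compact_supp Cc_in_supp)

lemma tb_ball_translate:
  fixes \<nu> :: "'g::{topological_ab_group_add, t2_space} functional"
  assumes "\<nu> \<in> tb_ball C"
  shows "translate_measure t \<nu> \<in> tb_ball C"
proof -
  have lin: "linear_functional_on Cc \<nu>" and zero: "\<And>f. f \<notin> Cc \<Longrightarrow> \<nu> f = 0"
    using assms by (auto simp: tb_ball_def)
  have tr: "(\<lambda>s. f (r + s)) \<in> Cc" if "f \<in> Cc" for f :: "'g \<Rightarrow> complex" and r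
    using Cc_translate[of f 0 "supp f" r] that by (simp add: Cc_in_supp Cc_compact_supp Cc_in_subset_Cc)
  \<comment> \<open>Both directions matter: the translated functional must again vanish outside
    \<open>Cc\<close>.\<close>
  have iff: "(\<lambda>s. f (t + s)) \<in> Cc \<longleftrightarrow> f \<in> Cc" for f :: "'g \<Rightarrow> complex"
    using tr[of f t] tr[of "\<lambda>s. f (t + s)" "- t"] by auto
  have sup: "sup_norm (\<lambda>s. f (t + s)) = sup_norm f" for f :: "'g \<Rightarrow> complex"
  proof -
    have "range (\<lambda>s. cmod (f (t + s))) = range (\<lambda>s. cmod (f s))"
    proof (intro subset_antisym image_subsetI)
      show "cmod (f s) \<in> range (\<lambda>s. cmod (f (t + s)))" for s
        by (rule range_eqI[of _ _ "s - t"]) simp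
    qed simp
    then show ?thesis by (simp add: sup_norm_def)
  qed
  show ?thesis
    unfolding tb_ball_def translate_measure_def
  proof (intro CollectI conjI allI impI ballI)
    show "linear_functional_on Cc (\<lambda>f. \<nu> (\<lambda>s. f (t + s)))"
      using lin by (simp add: linear_functional_on_def tr)
    show "\<nu> (\<lambda>s. f (t + s)) = 0" if "f \<notin> Cc" for f using that iff zero by blast
    show "cmod (\<nu> (\<lambda>s. f (t + s))) \<le> C K * sup_norm f" if "compact K" "f \<in> Cc_in ((+) x ` K)" for K x f
      using tb_ball_bound[OF assms that(1) Cc_translate[OF that(2,1), of t]] by (simp add: sup)
  qed
qed

text \<open>The seminorm \<open>\<lambda>f. cmod (\<nu> f)\<close> is Lipschitz on each
  \<open>Cc_in K\<close> and hence belongs to the family defining the inductive limit topology; it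
  bounds \<open>\<nu>\<close> with constant 1.\<close>

lemma tb_ball_radon:
  fixes \<nu> :: "'g::{topological_ab_group_add, t2_space} functional"
  assumes "\<nu> \<in> tb_ball C"
  shows "\<nu> \<in> radon_measures"
proof -
  have lin: "linear_functional_on Cc \<nu>" using assms by (simp add: tb_ball_def)
  have semi: "seminorm_on Cc (\<lambda>f. cmod (\<nu> f))" by (rule seminorm_on_linear_functional[OF lin])
  have cont: "continuous_map (seminorm_topology (Cc_in K) {sup_norm}) euclidean (\<lambda>f. cmod (\<nu> f))"
    if K: "compact K" for K
  proof (rule continuous_map_seminorm_topology_Lipschitz[where p=sup_norm])
    show fs: "function_space (Cc_in K :: ('g \<Rightarrow> complex) set)" by (rule function_space_Cc_in[OF K])
    show "seminorm_on (Cc_in K) (sup_norm :: ('g \<Rightarrow> complex) \<Rightarrow> real)"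
      by (intro seminorm_on_sup_norm Cc_bounded) (rule Cc_in_subset_Cc)
    fix f g :: "'g \<Rightarrow> complex" assume fg: "f \<in> Cc_in K" "g \<in> Cc_in K"
    have "\<bar>cmod (\<nu> g) - cmod (\<nu> f)\<bar> \<le> cmod (\<nu> (\<lambda>i. g i - f i))"
      using fg by (intro seminorm_on_reverse_triangle[OF function_space_Cc semi]) (rule Cc_in_subset_Cc, assumption)+
    also have "\<dots> \<le> C K * sup_norm (\<lambda>i. g i - f i)"
      using tb_ball_bound[OF assms K, of _ 0] function_space_diff[OF fs fg(2,1)] by simp
    finally show "dist (cmod (\<nu> g)) (cmod (\<nu> f)) \<le> C K * sup_norm (\<lambda>i. g i - f i)"
      by (simp add: dist_real_def)
  qed simp
  have "\<nu> \<in> dual Cc_topology"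
    unfolding Cc_topology_def
    by (rule linear_functional_on_bounded_dual[OF function_space_Cc _ semi lin, of _ 1])
      (use semi cont in auto)
  then show ?thesis using assms by (auto simp: radon_measures_def tb_ball_def)
qed

lemma variation_lower:
  assumes "g \<in> Cc" "\<And>x. cmod (g x) \<le> 1" "supp g \<subseteq> A"
  shows "ennreal (cmod (\<mu> g)) \<le> variation \<mu> A"
  unfolding variation_def using assms
  by (intro INF_greatest SUP_upper2[of g]) auto

text \<open>A test function divided by its sup norm competes in the supremum defining the variation,
  so the supremum over \<open>x\<close> of the variation of \<open>x + K\<close> can serve as
  \<open>C K\<close>.\<close>

lemma tb_measures_in_tb_ball:
  fixes \<mu> :: "'g::{topological_ab_group_add, t2_space} functional"
  assumes "\<mu> \<in> tb_measures"
  shows "\<exists>C. \<mu> \<in> tb_ball C"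
proof -
  have lin: "linear_functional_on Cc \<mu>" and zero: "\<forall>f. f \<notin> Cc \<longrightarrow> \<mu> f = 0"
    using assms by (auto simp: tb_measures_def radon_measures_def dual_def Cc_topology_def)
  define v where "v = (\<lambda>K. SUP x. variation \<mu> ((\<lambda>k. x + k) ` K))"
  have fin: "v K < \<infinity>" if "compact K" for K
    using assms that by (simp add: tb_measures_def v_def)
  have unit: "cmod (\<mu> g) \<le> enn2real (v K)"
    if K: "compact K" and g: "g \<in> Cc_in ((+) x ` K)" "\<And>x. cmod (g x) \<le> 1" for K x g
  proof -
    have "ennreal (cmod (\<mu> g)) \<le> variation \<mu> ((\<lambda>k. x + k) ` K)"
      using g by (intro variation_lower) (auto simp: Cc_in_def)
    also have "\<dots> \<le> v K" unfolding v_def by (rule SUP_upper) simp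
    also have "\<dots> = ennreal (enn2real (v K))" using fin[OF K] by simp
    finally show ?thesis by (simp add: ennreal_le_iff)
  qed
  have "cmod (\<mu> f) \<le> enn2real (v K) * sup_norm f" if K: "compact K" and f: "f \<in> Cc_in ((+) x ` K)" for K x f
  proof (cases "sup_norm f = 0")
    case True
    then have "f = (\<lambda>i. 0)"
      using sup_norm_upper[OF Cc_bounded[OF Cc_in_subset_Cc[OF f]]] by fastforce
    then show ?thesis using linear_functional_on_zero[OF function_space_Cc lin] True by simp
  next
    case False
    then have pos: "0 < sup_norm f"
      using sup_norm_nonneg[OF Cc_bounded[OF Cc_in_subset_Cc[OF f]]] by simp
    have "compact ((+) x ` K)" by (intro compact_continuous_image continuous_intros K)
    then have g: "(\<lambda>i. of_real (1 / sup_norm f) * f i) \<in> Cc_in ((+) x ` K)"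
      using function_space_scale[OF function_space_Cc_in f] by blast
    have "cmod (of_real (1 / sup_norm f) * f i) \<le> 1" for i
      using sup_norm_upper[OF Cc_bounded[OF Cc_in_subset_Cc[OF f]], of i] pos
      by (simp add: norm_mult norm_divide field_simps)
    from unit[OF K g this] have "cmod (of_real (1 / sup_norm f) * \<mu> f) \<le> enn2real (v K)"
      using linear_functional_on_scale[OF lin Cc_in_subset_Cc[OF f], of "of_real (1 / sup_norm f)"] by simp
    then show ?thesis using pos by (simp add: norm_mult norm_divide field_simps)
  qed
  then have "\<mu> \<in> tb_ball (\<lambda>K. enn2real (v K))"
    using lin zero by (simp add: tb_ball_def)
  then show ?thesis by blast
qed

text \<open>The variation of \<open>x + K\<close> is estimated through an open set around it. With a
  neighbourhood \<open>U\<close> of 0 inside a compact \<open>L\<close>, the set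
  \<open>x + K + U\<close> is open and contained in \<open>x + M\<close>, where
  \<open>M = K + L\<close>, so a single constant works for all \<open>x\<close>.\<close>

lemma tb_ball_tb_measures:
  fixes \<nu> :: "'g::{topological_ab_group_add, t2_space} functional"
  assumes lc: "locally_compact_space (euclidean :: 'g topology)" and \<nu>: "\<nu> \<in> tb_ball C"
  shows "\<nu> \<in> tb_measures"
  unfolding tb_measures_def
proof (intro CollectI conjI allI impI)
  show "\<nu> \<in> radon_measures" by (rule tb_ball_radon[OF \<nu>])
  fix K :: "'g set" assume K: "compact K"
  have "\<exists>U :: 'g set. open U \<and> (\<exists>L. compact L \<and> 0 \<in> U \<and> U \<subseteq> L)"
    using lc unfolding locally_compact_space_def by simp
  then obtain U L :: "'g set" where U: "open U" "0 \<in> U" "U \<subseteq> L" and L: "compact L"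
    by blast
  define M where "M = (\<lambda>(k, l). k + l) ` (K \<times> L)"
  have M: "compact M" unfolding M_def
    by (intro compact_continuous_image compact_Times K L) (auto simp: split_def intro!: continuous_intros)
  have "variation \<nu> ((\<lambda>k. x + k) ` K) \<le> ennreal (\<bar>C M\<bar> * 1)" for x
  proof -
    define O' where "O' = (\<Union>k\<in>K. (\<lambda>z. z - (x + k)) -` U)"
    have "open O'" unfolding O'_def using U(1) by (intro open_UN ballI open_vimage continuous_intros)
    moreover have "(\<lambda>k. x + k) ` K \<subseteq> O'"
      unfolding O'_def using U(2) by auto
    moreover have "O' \<subseteq> (+) x ` M"
    proof
      fix z assume "z \<in> O'"
      then obtain k where k: "k \<in> K" "z - (x + k) \<in> U" by (auto simp: O'_def)
      then have "k + (z - (x + k)) \<in> M"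
        unfolding M_def using U(3) by (intro image_eqI[of _ _ "(k, z - (x + k))"]) auto
      then show "z \<in> (+) x ` M" by (rule rev_image_eqI) simp
    qed
    then have "ennreal (cmod (\<nu> g)) \<le> ennreal (\<bar>C M\<bar> * 1)"
      if g: "g \<in> Cc" "\<And>x. cmod (g x) \<le> 1" "supp g \<subseteq> O'" for g
    proof -
      have "g \<in> Cc_in ((+) x ` M)" using g \<open>O' \<subseteq> (+) x ` M\<close> by (auto simp: Cc_in_def)
      from tb_ball_bound_sup[OF \<nu> M this g(2)] show ?thesis by (rule ennreal_leI)
    qed
    ultimately show ?thesis unfolding variation_def
      by (intro INF_lower2[of O'] SUP_least) auto
  qed
  then have "(SUP x. variation \<nu> ((\<lambda>k. x + k) ` K)) \<le> ennreal (\<bar>C M\<bar> * 1)" by (rule SUP_least)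
  then show "(SUP x. variation \<nu> ((\<lambda>k. x + k) ` K)) < \<infinity>"
    by (simp add: le_less_trans)
qed

section \<open>Convolution of measures with test functions\<close>

lemma conv_add: "conv c (\<lambda>f. \<mu> f + \<nu> f) = (\<lambda>x. conv c \<mu> x + conv c \<nu> x)"
  by (simp add: conv_def)

lemma conv_scale: "conv c (\<lambda>f. a * \<mu> f) = (\<lambda>x. a * conv c \<mu> x)"
  by (simp add: conv_def)

lemma conv_diff: "conv c (\<lambda>f. \<mu> f - \<nu> f) = (\<lambda>x. conv c \<mu> x - conv c \<nu> x)"
  by (simp add: conv_def)

text \<open>Identifies the orbit of \<open>conv c \<mu>\<close> with the image of the orbit of
  \<open>\<mu>\<close> under \<open>conv c\<close>.\<close>

lemma translate_conv: "translate t (conv c \<mu>) = conv c (translate_measure t \<mu>)"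
  by (simp add: translate_def conv_def translate_measure_def fun_eq_iff algebra_simps)

text \<open>Allows \<open>\<nu> f\<close> to be recovered as the value at 0 of the convolution of
  \<open>\<nu>\<close> with the reflected \<open>f\<close>.\<close>

lemma Cc_reflect_zero:
  fixes f :: "'g::{topological_ab_group_add, t2_space} \<Rightarrow> complex"
  shows "f \<in> Cc \<Longrightarrow> (\<lambda>s. f (- s)) \<in> Cc"
  using Cc_in_subset_Cc[OF Cc_reflect[of f 0]] by simp

lemma function_space_tb_measures:
  assumes lc: "locally_compact_space (euclidean :: 'g::{topological_ab_group_add, t2_space} topology)"
  shows "function_space (tb_measures :: 'g functional set)"
  unfolding function_space_def
proof (intro conjI ballI allI)
  show "(\<lambda>i. 0) \<in> (tb_measures :: 'g functional set)"
    by (rule tb_ball_tb_measures[OF lc, of _ "\<lambda>_. 0"]) (simp add: tb_ball_def linear_functional_on_def)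
next
  fix \<mu> \<nu> :: "'g functional" assume "\<mu> \<in> tb_measures" "\<nu> \<in> tb_measures"
  then obtain C D where CD: "\<mu> \<in> tb_ball C" "\<nu> \<in> tb_ball D"
    using tb_measures_in_tb_ball by blast
  have "cmod (\<mu> f + \<nu> f) \<le> (C K + D K) * sup_norm f" if "compact K" "f \<in> Cc_in ((+) x ` K)" for K x f
    using norm_triangle_mono[OF tb_ball_bound[OF CD(1) that] tb_ball_bound[OF CD(2) that]]
    by (simp add: distrib_right)
  then have "(\<lambda>f. \<mu> f + \<nu> f) \<in> tb_ball (\<lambda>K. C K + D K)"
    using CD by (auto simp: tb_ball_def linear_functional_on_def algebra_simps)
  then show "(\<lambda>f. \<mu> f + \<nu> f) \<in> tb_measures" by (rule tb_ball_tb_measures[OF lc])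
next
  fix \<mu> :: "'g functional" and a assume "\<mu> \<in> tb_measures"
  then obtain C where C: "\<mu> \<in> tb_ball C" using tb_measures_in_tb_ball by blast
  have "cmod (a * \<mu> f) \<le> (cmod a * C K) * sup_norm f" if "compact K" "f \<in> Cc_in ((+) x ` K)" for K x f
    using mult_left_mono[OF tb_ball_bound[OF C that], of "cmod a"] by (simp add: norm_mult mult.assoc)
  then have "(\<lambda>f. a * \<mu> f) \<in> tb_ball (\<lambda>K. cmod a * C K)"
    using C by (auto simp: tb_ball_def linear_functional_on_def algebra_simps)
  then show "(\<lambda>f. a * \<mu> f) \<in> tb_measures" by (rule tb_ball_tb_measures[OF lc])
qed

text \<open>If \<open>x - y\<close> lies in a compact neighbourhood \<open>L\<close> of 0, the
  reflected translates of \<open>c\<close> at \<open>x\<close> and at \<open>y\<close> are both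
  supported in \<open>y + M\<close> with \<open>M = L - supp c\<close>. Their difference is
  uniformly small, and the bound for \<open>M\<close> does not depend on \<open>y\<close>.\<close>

lemma conv_in_Cu:
  fixes \<nu> :: "'g::{topological_ab_group_add, t2_space} functional"
  assumes lc: "locally_compact_space (euclidean :: 'g topology)"
    and "\<nu> \<in> tb_measures" and c: "c \<in> Cc"
  shows "conv c \<nu> \<in> Cu"
proof -
  obtain C where \<nu>: "\<nu> \<in> tb_ball C" using tb_measures_in_tb_ball assms(2) by blast
  define K where "K = uminus ` supp c"
  have K: "compact K" unfolding K_def
    by (intro compact_continuous_image continuous_intros Cc_compact_supp c)
  have refl: "(\<lambda>s. c (x - s)) \<in> Cc_in ((+) x ` K)" for x
    unfolding K_def by (rule Cc_reflect[OF c])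
  have "cmod (conv c \<nu> x) \<le> \<bar>C K\<bar> * sup_norm c" for x
    unfolding conv_def by (intro tb_ball_bound_sup[OF \<nu> K refl] sup_norm_upper Cc_bounded c)
  then have "bounded (range (conv c \<nu>))" by (intro boundedI) auto
  moreover have "\<exists>U. open U \<and> 0 \<in> U \<and> (\<forall>x y. x - y \<in> U \<longrightarrow> dist (conv c \<nu> x) (conv c \<nu> y) < e)"
    if e: "0 < e" for e
  proof -
    have "\<exists>U :: 'g set. open U \<and> (\<exists>L. compact L \<and> 0 \<in> U \<and> U \<subseteq> L)"
      using lc unfolding locally_compact_space_def by simp
    then obtain U L :: "'g set" where U: "open U" "0 \<in> U" "U \<subseteq> L" and L: "compact L"
      by blast
    define M where "M = (\<lambda>(l, k). l + k) ` (L \<times> K)"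
    have M: "compact M" unfolding M_def
      by (intro compact_continuous_image compact_Times K L) (auto simp: split_def intro!: continuous_intros)
    define d where "d = e / (\<bar>C M\<bar> + 1)"
    have d: "0 < d" using e by (simp add: d_def)
    obtain W where W: "open W" "0 \<in> W" "\<And>x y. x - y \<in> W \<Longrightarrow> dist (c x) (c y) < d"
      using Cc_uniformly_continuous[OF c d] by blast
    have "dist (conv c \<nu> x) (conv c \<nu> y) < e" if xy: "x - y \<in> U \<inter> W" for x y
    proof -
      define f where "f = (\<lambda>s. c (x - s) - c (y - s))"
      have fCc: "f \<in> Cc" unfolding f_def
        by (rule function_space_diff[OF function_space_Cc]; rule Cc_in_subset_Cc[OF refl])
      have "f \<in> Cc_in ((+) y ` M)"
      proof (rule Cc_inI)
        show "continuous_on UNIV f" by (rule Cc_continuous[OF fCc])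
        show "compact ((+) y ` M)" by (intro compact_continuous_image continuous_intros M)
        fix s assume s: "s \<notin> (+) y ` M"
        \<comment> \<open>Treats both functions at once: \<open>l = x - y\<close> for the first and
          \<open>l = 0\<close> for the second.\<close>
        have "c (y + l - s) = 0" if "l \<in> L" for l
        proof (rule not_in_supp[of _ c], rule notI)
          assume "y + l - s \<in> supp c"
          then have "(l, - (y + l - s)) \<in> L \<times> K" using that unfolding K_def by blast
          then have "l + - (y + l - s) \<in> M" unfolding M_def by (rule rev_image_eqI) simp
          then have "y + (l + - (y + l - s)) \<in> (+) y ` M" by (rule imageI)
          then show False using s by (simp add: algebra_simps)
        qed
        moreover have "x - y \<in> L" "0 \<in> L" using xy U by auto
        ultimately have "c (y + (x - y) - s) = 0" "c (y + 0 - s) = 0" by blast+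
        then show "f s = 0" by (simp add: f_def)
      qed
      moreover have "cmod (f s) \<le> d" for s
        using W(3)[of "x - s" "y - s"] xy by (simp add: f_def dist_norm)
      ultimately have "cmod (\<nu> f) \<le> \<bar>C M\<bar> * d" by (rule tb_ball_bound_sup[OF \<nu> M])
      also have "\<dots> < (\<bar>C M\<bar> + 1) * d" using d by simp
      also have "\<dots> = e" by (simp add: d_def)
      finally have "cmod (\<nu> f) < e" .
      moreover have "\<nu> f = conv c \<nu> x - conv c \<nu> y"
        unfolding f_def conv_def
        by (rule linear_functional_on_diff[OF function_space_Cc _ Cc_in_subset_Cc[OF refl] Cc_in_subset_Cc[OF refl]])
          (use \<nu> in \<open>simp add: tb_ball_def\<close>)
      ultimately show ?thesis by (simp add: dist_norm)
    qed
    then show ?thesis using U W by (intro exI[of _ "U \<inter> W"]) auto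
  qed
  ultimately show ?thesis by (simp add: Cu_def)
qed

section \<open>The product and the weak topology for measures\<close>

lemma seminorm_on_conv:
  assumes lc: "locally_compact_space (euclidean :: 'g::{topological_ab_group_add, t2_space} topology)"
    and c: "c \<in> Cc"
  shows "seminorm_on (tb_measures :: 'g functional set) (\<lambda>\<mu>. sup_norm (conv c \<mu>))"
  by (rule seminorm_on_compose[OF seminorm_on_Cu_sup_norm])
    (auto simp: conv_add conv_scale intro: conv_in_Cu[OF lc _ c])

lemma topspace_Cu_topology [simp]: "topspace Cu_topology = Cu"
  by (simp add: Cu_topology_def)

lemma topspace_product_topology_measures [simp]: "topspace product_topology_measures = tb_measures"
  by (simp add: product_topology_measures_def)

lemma topspace_weak_topology_measures [simp]: "topspace weak_topology_measures = tb_measures"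
  by (simp add: weak_topology_measures_def)

lemma continuous_map_eval_Cu:
  fixes x :: "'g::topological_ab_group_add"
  shows "continuous_map Cu_topology euclidean (\<lambda>f. f x)"
  unfolding Cu_topology_def
proof (rule continuous_map_seminorm_topology_Lipschitz[OF function_space_Cu _ seminorm_on_Cu_sup_norm])
  fix f g :: "'g \<Rightarrow> complex" assume "f \<in> Cu" "g \<in> Cu"
  then have "(\<lambda>i. g i - f i) \<in> Cu" using function_space_diff[OF function_space_Cu] by blast
  then show "dist (g x) (f x) \<le> 1 * sup_norm (\<lambda>i. g i - f i)"
    using sup_norm_upper[OF Cu_bounded, of "\<lambda>i. g i - f i" x] by (simp add: dist_norm)
qed simp

text \<open>Point evaluations belong to the dual of \<open>Cu_topology\<close>, so even the weak
  topology refines pointwise convergence.\<close>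

lemma continuous_map_eval_weak_Cu:
  "continuous_map (weak_topology Cu_topology) euclidean (\<lambda>f. f x)"
  by (rule continuous_map_weak_topology_dual)
    (auto simp: function_space_Cu dual_def linear_functional_on_def continuous_map_eval_Cu)

lemma continuous_map_conv_product:
  fixes c :: "'g::{topological_ab_group_add, t2_space} \<Rightarrow> complex"
  assumes lc: "locally_compact_space (euclidean :: 'g topology)" and c: "c \<in> Cc"
  shows "continuous_map product_topology_measures Cu_topology (conv c)"
  unfolding product_topology_measures_def Cu_topology_def
proof (rule continuous_map_seminorm_topologies_linear[OF function_space_tb_measures[OF lc] function_space_Cu])
  show "\<exists>p\<in>{\<lambda>\<mu>. sup_norm (conv c \<mu>) |c. c \<in> Cc}. seminorm_on tb_measures p \<and>
      (\<forall>f\<in>tb_measures. q (conv c f) \<le> p f)" if "q \<in> {sup_norm}" for q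
    using that c seminorm_on_conv[OF lc c] by (intro bexI[of _ "\<lambda>\<mu>. sup_norm (conv c \<mu>)"]) auto
qed (use conv_in_Cu[OF lc _ c] in \<open>auto simp: conv_diff seminorm_on_Cu_sup_norm\<close>)

lemma continuous_map_into_product_topology_measures:
  assumes lc: "locally_compact_space (euclidean :: 'g::{topological_ab_group_add, t2_space} topology)"
    and X: "topspace X \<subseteq> (tb_measures :: 'g functional set)"
    and conv: "\<And>c. c \<in> Cc \<Longrightarrow> continuous_map X Cu_topology (conv c)"
  shows "continuous_map X product_topology_measures (\<lambda>\<mu>. \<mu>)"
  unfolding product_topology_measures_def
proof (rule continuous_map_into_seminorm_topology)
  fix p and x :: "'g functional" and e :: real
  assume "p \<in> {\<lambda>\<mu> :: 'g functional. sup_norm (conv c \<mu>) |c. c \<in> Cc}" and x: "x \<in> tb_measures" and e: "0 < e"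
  then obtain c where c: "c \<in> Cc" "p = (\<lambda>\<mu>. sup_norm (conv c \<mu>))" by blast
  \<comment> \<open>A subbasic ball around \<open>x\<close> is the preimage under
    \<open>conv c\<close> of a norm ball around \<open>conv c x\<close>.\<close>
  have "openin Cu_topology {f \<in> Cu. sup_norm (\<lambda>i. f i - conv c x i) < e}"
    unfolding Cu_topology_def using conv_in_Cu[OF lc x c(1)] e by (intro openin_seminorm_ball) auto
  from openin_continuous_map_preimage[OF conv[OF c(1)] this]
  show "openin X {z \<in> topspace X. p (\<lambda>i. z i - x i) < e}"
    using continuous_map_funspace[OF conv[OF c(1)]]
    by (simp add: c(2) conv_diff Pi_iff cong: conj_cong)
qed (use X in auto)

lemma continuous_map_conv_weak:
  fixes c :: "'g::{topological_ab_group_add, t2_space} \<Rightarrow> complex"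
  assumes lc: "locally_compact_space (euclidean :: 'g topology)" and c: "c \<in> Cc"
  shows "continuous_map weak_topology_measures (weak_topology Cu_topology) (conv c)"
  unfolding weak_topology_measures_def
proof (rule continuous_map_into_weak_topology)
  fix \<psi> :: "('g \<Rightarrow> complex) \<Rightarrow> complex" assume \<psi>: "\<psi> \<in> dual Cu_topology"
  show "continuous_map (weak_topology product_topology_measures) euclidean (\<lambda>z. \<psi> (conv c z))"
  proof (rule continuous_map_weak_topology_dual)
    have "continuous_map product_topology_measures euclidean (\<psi> \<circ> conv c)"
      using \<psi> continuous_map_conv_product[OF lc c] by (auto simp: dual_def intro: continuous_map_compose)
    moreover have "linear_functional_on tb_measures (\<lambda>z. \<psi> (conv c z))"
      using \<psi> conv_in_Cu[OF lc _ c]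
      by (auto simp: dual_def linear_functional_on_def conv_add conv_scale)
    ultimately show "(\<lambda>z. \<psi> (conv c z)) \<in> dual product_topology_measures"
      by (simp add: dual_def o_def)
  qed (simp add: function_space_tb_measures[OF lc])
qed (simp_all add: function_space_Cu conv_in_Cu[OF lc _ c])

lemma dual_product_topology_measures:
  fixes \<phi> :: "'g::{topological_ab_group_add, t2_space} functional \<Rightarrow> complex"
  assumes lc: "locally_compact_space (euclidean :: 'g topology)"
    and \<phi>: "\<phi> \<in> dual product_topology_measures"
  obtains S \<psi> where "finite S" "S \<subseteq> Cc" "\<And>c. c \<in> S \<Longrightarrow> \<psi> c \<in> dual Cu_topology"
    "\<And>\<mu>. \<mu> \<in> tb_measures \<Longrightarrow> \<phi> \<mu> = (\<Sum>c\<in>S. \<psi> c (conv c \<mu>))"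
proof -
  define N where "N = (\<lambda>c (\<mu> :: 'g functional). sup_norm (conv c \<mu>))"
  have fam: "{\<lambda>\<mu> :: 'g functional. sup_norm (conv c \<mu>) |c. c \<in> Cc} = N ` Cc"
    by (auto simp: N_def)
  have tb: "function_space (tb_measures :: 'g functional set)" by (rule function_space_tb_measures[OF lc])
  have semi: "seminorm_on tb_measures p" if "p \<in> N ` Cc" for p
    using that seminorm_on_conv[OF lc] by (auto simp: N_def)
  obtain F C where F: "finite F" "F \<subseteq> N ` Cc" "0 \<le> C"
    and bound: "\<And>\<mu>. \<mu> \<in> tb_measures \<Longrightarrow> cmod (\<phi> \<mu>) \<le> C * (\<Sum>p\<in>F. p \<mu>)"
    by (rule dual_seminorm_topology_bounded[OF tb semi \<phi>[unfolded product_topology_measures_def fam]], assumption, rule that)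
  \<comment> \<open>Different \<open>c\<close> may induce the same seminorm; one \<open>c\<close> is
    chosen for each, so that the sum over \<open>F\<close> can be reindexed by
    \<open>S\<close>.\<close>
  obtain S where S: "S \<subseteq> Cc" "finite S" "F = N ` S" "inj_on N S"
    using F(1,2) by (metis finite_imageD subset_image_inj)
  have lin: "linear_functional_on tb_measures \<phi>" using \<phi> by (simp add: dual_def)
  have "\<exists>\<psi>. (\<forall>c\<in>S. \<psi> c \<in> dual (seminorm_topology Cu {sup_norm})) \<and>
    (\<forall>\<mu>\<in>tb_measures. \<phi> \<mu> = (\<Sum>c\<in>S. \<psi> c (conv c \<mu>)))"
  proof (rule dual_decomposition[OF tb function_space_Cu seminorm_on_Cu_sup_norm S(2) F(3) _ _ _ lin])
    show "cmod (\<phi> \<mu>) \<le> C * (\<Sum>c\<in>S. sup_norm (conv c \<mu>))" if "\<mu> \<in> tb_measures" for \<mu>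
      using bound[OF that] S(3,4) by (simp add: sum.reindex) (simp add: N_def)
  qed (use S conv_in_Cu[OF lc] in \<open>auto simp: conv_add conv_scale\<close>)
  then show thesis using S that unfolding Cu_topology_def by blast
qed

lemma continuous_map_into_weak_topology_measures:
  assumes lc: "locally_compact_space (euclidean :: 'g::{topological_ab_group_add, t2_space} topology)"
    and X: "topspace X \<subseteq> (tb_measures :: 'g functional set)"
    and conv: "\<And>c. c \<in> Cc \<Longrightarrow> continuous_map X (weak_topology Cu_topology) (conv c)"
  shows "continuous_map X weak_topology_measures (\<lambda>\<mu>. \<mu>)"
  unfolding weak_topology_measures_def
proof (rule continuous_map_into_weak_topology)
  fix \<phi> :: "'g functional \<Rightarrow> complex" assume \<phi>: "\<phi> \<in> dual product_topology_measures"
  obtain S \<psi> where S: "finite S" "S \<subseteq> Cc" "\<And>c. c \<in> S \<Longrightarrow> \<psi> c \<in> dual Cu_topology"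
    and eq: "\<And>\<mu>. \<mu> \<in> tb_measures \<Longrightarrow> \<phi> \<mu> = (\<Sum>c\<in>S. \<psi> c (conv c \<mu>))"
    by (rule dual_product_topology_measures[OF lc \<phi>], rule that)
  have "continuous_map X euclidean (\<psi> c \<circ> conv c)" if "c \<in> S" for c
  proof (rule continuous_map_compose)
    show "continuous_map X (weak_topology Cu_topology) (conv c)" using conv that S(2) by blast
    show "continuous_map (weak_topology Cu_topology) euclidean (\<psi> c)"
      by (rule continuous_map_weak_topology_dual) (simp_all add: function_space_Cu S(3) that)
  qed
  then have "continuous_map X euclidean (\<lambda>\<mu>. \<Sum>c\<in>S. \<psi> c (conv c \<mu>))"
    using S(1) by (intro continuous_map_sum) (simp_all add: o_def)
  then show "continuous_map X euclidean (\<lambda>\<mu>. \<phi> \<mu>)"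
    by (rule continuous_map_eq) (use X eq in auto)
qed (use X function_space_tb_measures[OF lc] in auto)

section \<open>The vague hull\<close>

lemma topology_eqI_continuous_map_id:
  assumes "continuous_map X Y (\<lambda>x. x)" "continuous_map Y X (\<lambda>x. x)"
  shows "X = Y"
proof -
  have "topspace X = topspace Y"
    using continuous_map_funspace[OF assms(1)] continuous_map_funspace[OF assms(2)] by auto
  moreover from this have "openin X U \<longleftrightarrow> openin Y U" for U
    using openin_continuous_map_preimage[OF assms(1), of U] openin_continuous_map_preimage[OF assms(2), of U]
      openin_subset[of X U] openin_subset[of Y U] by (auto simp: Int_absorb1 Int_def[symmetric] Collect_conj_eq)
  ultimately show ?thesis by (simp add: topology_eq)
qed

lemma continuous_map_into_fun:
  "continuous_map X (euclidean :: ('a \<Rightarrow> 'b::topological_space) topology) g \<longleftrightarrow>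
     (\<forall>i. continuous_map X euclidean (\<lambda>x. g x i))"
  unfolding euclidean_product_topology[symmetric] by (rule continuous_map_componentwise_UNIV)

lemma Hausdorff_space_euclidean_fun:
  "Hausdorff_space (euclidean :: ('a \<Rightarrow> 'b::metric_space) topology)"
  unfolding euclidean_product_topology[symmetric] by (simp add: Hausdorff_space_product_topology)

lemma compact_imp_closed_fun: "compact K \<Longrightarrow> closed K" for K :: "('a \<Rightarrow> 'b::metric_space) set"
  using compactin_imp_closedin[OF Hausdorff_space_euclidean_fun, of K] by simp

lemma function_space_radon_measures:
  "function_space (radon_measures :: 'g::topological_space functional set)"
  unfolding function_space_def
proof (intro conjI ballI allI)
  show "(\<lambda>i. 0) \<in> (radon_measures :: 'g functional set)"
    by (simp add: radon_measures_def dual_def linear_functional_on_def)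
next
  fix \<mu> \<nu> :: "'g functional" assume "\<mu> \<in> radon_measures" "\<nu> \<in> radon_measures"
  then show "(\<lambda>f. \<mu> f + \<nu> f) \<in> radon_measures"
    by (simp add: radon_measures_def dual_def linear_functional_on_def algebra_simps continuous_map_add)
next
  fix \<mu> :: "'g functional" and a assume "\<mu> \<in> radon_measures"
  moreover from this have "continuous_map Cc_topology euclidean (\<lambda>f. a * \<mu> f)"
    using continuous_map_compose[of Cc_topology euclidean \<mu> euclidean "\<lambda>z. a * z"]
    by (simp add: radon_measures_def dual_def o_def continuous_intros)
  ultimately show "(\<lambda>f. a * \<mu> f) \<in> radon_measures"
    by (simp add: radon_measures_def dual_def linear_functional_on_def algebra_simps)
qed

text \<open>Measures vanish outside \<open>Cc\<close>, so evaluation at any other function is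
  constant, and convergence at all functions is the same as convergence on
  \<open>Cc\<close>.\<close>

lemma vague_topology_eq:
  "vague_topology = top_of_set (radon_measures :: 'g::topological_space functional set)"
proof (rule topology_eqI_continuous_map_id)
  have zero: "\<mu> f = 0" if "\<mu> \<in> radon_measures" "f \<notin> Cc" for \<mu> :: "'g functional" and f
    using that by (simp add: radon_measures_def)
  have "continuous_map vague_topology euclidean (\<lambda>\<mu> :: 'g functional. \<mu> f)" for f
  proof (cases "f \<in> Cc")
    case True
    let ?p = "\<lambda>\<mu> :: 'g functional. cmod (\<mu> f)"
    have "seminorm_on radon_measures ?p"
      by (rule seminorm_on_linear_functional) (simp add: linear_functional_on_def)
    moreover have "?p \<in> {\<lambda>\<mu>. cmod (\<mu> f) |f. f \<in> Cc}" using True by blast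
    ultimately show ?thesis
      unfolding vague_topology_def
      by (intro continuous_map_seminorm_topology_Lipschitz[OF function_space_radon_measures, of ?p _ _ 1])
        (simp_all add: dist_norm)
  next
    case False
    have "continuous_map vague_topology euclidean (\<lambda>\<mu> :: 'g functional. 0 :: complex)" by simp
    then show ?thesis
      by (rule continuous_map_eq) (simp add: zero[OF _ False] vague_topology_def)
  qed
  then show "continuous_map vague_topology (top_of_set (radon_measures :: 'g functional set)) (\<lambda>\<mu>. \<mu>)"
    by (simp add: continuous_map_in_subtopology continuous_map_into_fun vague_topology_def)
  show "continuous_map (top_of_set (radon_measures :: 'g functional set)) vague_topology (\<lambda>\<mu>. \<mu>)"
    unfolding vague_topology_def
  proof (rule continuous_map_into_seminorm_topology_real)
    fix p and x :: "'g functional" assume "p \<in> {\<lambda>\<mu> :: 'g functional. cmod (\<mu> f) |f. f \<in> Cc}"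
    then obtain f where "p = (\<lambda>\<mu>. cmod (\<mu> f))" by blast
    then show "continuous_map (top_of_set radon_measures) euclidean (\<lambda>z. p (\<lambda>i. z i - x i))"
      by (auto intro!: continuous_intros continuous_on_subset[OF continuous_on_product_coordinates])
  qed simp
qed

text \<open>A Banach-Alaoglu argument: the defining conditions are closed, as each involves finitely
  many coordinates, and the set sits in a product of discs. Their radii come from the estimate on
  \<open>supp f\<close>, with radius 0 for \<open>f\<close> outside \<open>Cc\<close>.\<close>

lemma compact_tb_ball: "compact (tb_ball C :: 'g::{topological_ab_group_add, t2_space} functional set)"
proof -
  have coord: "continuous_on UNIV (\<lambda>\<nu> :: 'g functional. \<nu> f)" for f
    by (rule continuous_on_product_coordinates)
  have "closed (tb_ball C :: 'g functional set)"
    unfolding tb_ball_def linear_functional_on_def Ball_def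
    by (intro closed_Collect_conj closed_Collect_all closed_Collect_imp open_Collect_const
        closed_Collect_eq closed_Collect_le continuous_intros coord)
  moreover define P where
    "P = (\<Pi>\<^sub>E f\<in>UNIV. cball (0 :: complex) (if f \<in> Cc then C (supp f) * sup_norm f else 0))"
  have "compactin (product_topology (\<lambda>_. euclidean) UNIV) P"
    by (simp add: P_def compactin_PiE)
  then have "compact P" by (simp add: euclidean_product_topology)
  ultimately have "compact (tb_ball C \<inter> P)" by (rule closed_Int_compact)
  moreover have "tb_ball C \<subseteq> P"
  proof
    fix \<nu> :: "'g functional" assume \<nu>: "\<nu> \<in> tb_ball C"
    have "\<nu> f \<in> cball 0 (if f \<in> Cc then C (supp f) * sup_norm f else 0)" for f
      using tb_ball_bound_Cc[OF \<nu>, of f] \<nu> by (simp add: tb_ball_def)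
    then show "\<nu> \<in> P" by (simp add: P_def PiE_UNIV_domain)
  qed
  ultimately show ?thesis by (simp add: Int_absorb2)
qed

lemma orbit_subset_tb_ball: "\<mu> \<in> tb_ball C \<Longrightarrow> orbit \<mu> \<subseteq> tb_ball C"
  for \<mu> :: "'g::{topological_ab_group_add, t2_space} functional"
  by (auto simp: orbit_def tb_ball_translate)

lemma closure_orbit_subset_tb_ball: "\<mu> \<in> tb_ball C \<Longrightarrow> closure (orbit \<mu>) \<subseteq> tb_ball C"
  for \<mu> :: "'g::{topological_ab_group_add, t2_space} functional"
  by (intro closure_minimal orbit_subset_tb_ball compact_imp_closed_fun compact_tb_ball)

text \<open>Pointwise limits of the orbit stay in a closed \<open>tb_ball\<close> and are therefore
  Radon measures, so closing within \<open>radon_measures\<close> loses nothing.\<close>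

lemma vague_hull_eq_closure:
  fixes \<mu> :: "'g::{topological_ab_group_add, t2_space} functional"
  assumes "\<mu> \<in> tb_measures"
  shows "vague_hull \<mu> = closure (orbit \<mu>)"
proof -
  obtain C where C: "\<mu> \<in> tb_ball C" using tb_measures_in_tb_ball[OF assms] by blast
  have "closure (orbit \<mu>) \<subseteq> radon_measures" "orbit \<mu> \<subseteq> radon_measures"
    using closure_orbit_subset_tb_ball[OF C] orbit_subset_tb_ball[OF C] tb_ball_radon by auto
  then show ?thesis
    by (simp add: vague_hull_def vague_topology_eq closure_of_subtopology Int_absorb1)
qed

text \<open>Each coordinate of a translated functional is a coordinate of the original one, so
  translation is continuous and maps the closure of the orbit into itself.\<close>

lemma vague_hull_translate:
  fixes \<mu> :: "'g::{topological_ab_group_add, t2_space} functional"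
  assumes "\<mu> \<in> tb_measures" "\<nu> \<in> vague_hull \<mu>"
  shows "translate_measure t \<nu> \<in> vague_hull \<mu>"
proof -
  have "continuous_on UNIV (translate_measure t :: 'g functional \<Rightarrow> 'g functional)"
    unfolding translate_measure_def
    by (intro continuous_on_coordinatewise_then_product continuous_on_product_coordinates)
  then have "continuous_on (closure (orbit \<mu>)) (translate_measure t)"
    by (rule continuous_on_subset) simp
  moreover have "translate_measure t (translate_measure s \<mu>) = translate_measure (t + s) \<mu>" for s
    by (simp add: translate_measure_def add_ac)
  then have "translate_measure t ` orbit \<mu> \<subseteq> closure (orbit \<mu>)"
    using closure_subset[of "orbit \<mu>"] by (auto simp: orbit_def)
  ultimately have "translate_measure t ` closure (orbit \<mu>) \<subseteq> closure (orbit \<mu>)"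
    by (intro image_closure_subset) simp_all
  then show ?thesis using assms by (auto simp: vague_hull_eq_closure)
qed

section \<open>Almost periodicity\<close>

text \<open>Serves both halves of the theorem: \<open>T\<close> is the norm or the weak topology on
  functions, \<open>M\<close> the corresponding topology on measures. The hypotheses say that
  \<open>M\<close> is initial for the convolution maps into \<open>T\<close> and that
  \<open>T\<close> refines pointwise convergence. The implications form the cycle (i), (iii), (ii),
  (iv), (i).\<close>

lemma almost_periodic_hull_equivalences:
  fixes \<mu> :: "'g::{topological_ab_group_add, t2_space} functional"
    and T :: "('g \<Rightarrow> complex) topology" and M :: "'g functional topology"
  assumes lc: "locally_compact_space (euclidean :: 'g topology)"
    and \<mu>: "\<mu> \<in> tb_measures"
    and eval: "\<And>x. continuous_map T euclidean (\<lambda>f. f x)"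
    and M: "topspace M = tb_measures"
    and conv: "\<And>c. c \<in> Cc \<Longrightarrow> continuous_map M T (conv c)"
    and initial: "\<And>X. topspace X \<subseteq> tb_measures \<Longrightarrow>
      (\<And>c. c \<in> Cc \<Longrightarrow> continuous_map X T (conv c)) \<Longrightarrow> continuous_map X M (\<lambda>\<nu>. \<nu>)"
    and AP: "\<And>\<nu>. \<nu> \<in> AP \<longleftrightarrow>
      \<nu> \<in> tb_measures \<and> (\<forall>c\<in>Cc. precompact_in T (range (\<lambda>t. translate t (conv c \<nu>))))"
  shows "(\<mu> \<in> AP \<longleftrightarrow> vague_hull \<mu> = M closure_of orbit \<mu> \<and> compactin M (vague_hull \<mu>)) \<and>
    (\<mu> \<in> AP \<longleftrightarrow> subtopology vague_topology (vague_hull \<mu>) = subtopology M (vague_hull \<mu>)) \<and>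
    (\<mu> \<in> AP \<longleftrightarrow> vague_hull \<mu> \<subseteq> AP)"
proof -
  define H where "H = vague_hull \<mu>"
  obtain C where C: "\<mu> \<in> tb_ball C" using tb_measures_in_tb_ball[OF \<mu>] by blast
  have H_eq: "H = closure (orbit \<mu>)" unfolding H_def by (rule vague_hull_eq_closure[OF \<mu>])
  have H_ball: "H \<subseteq> tb_ball C" unfolding H_eq by (rule closure_orbit_subset_tb_ball[OF C])
  have H_tb: "H \<subseteq> tb_measures" using H_ball tb_ball_tb_measures[OF lc] by blast
  have H_vague: "subtopology vague_topology H = top_of_set H"
  proof -
    have "radon_measures \<inter> H = H" using H_ball tb_ball_radon by blast
    then show ?thesis by (simp add: vague_topology_eq subtopology_subtopology)
  qed
  have "compact (tb_ball C \<inter> H)" unfolding H_eq by (intro compact_Int_closed compact_tb_ball closed_closure)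
  then have H_compact: "compact H" using H_ball by (simp add: Int_absorb1)
  have orbit_H: "orbit \<mu> \<subseteq> H" unfolding H_eq by (rule closure_subset)
  have "\<mu> \<in> orbit \<mu>" unfolding orbit_def by (rule range_eqI[of _ _ 0]) (simp add: translate_measure_def)
  then have \<mu>_H: "\<mu> \<in> H" using orbit_H by blast
  have id_T: "continuous_map T euclidean (\<lambda>f. f)"
    using eval by (simp add: continuous_map_into_fun)
  \<comment> \<open>\<open>M\<close> refines pointwise convergence, since \<open>\<nu> f\<close> is
    the value at 0 of a convolution.\<close>
  have "continuous_map M euclidean (\<lambda>\<nu>. \<nu> f)" for f
  proof (cases "f \<in> Cc")
    case True
    have "continuous_map M euclidean ((\<lambda>h. h 0) \<circ> conv (\<lambda>s. f (- s)))"
      by (rule continuous_map_compose[OF conv[OF Cc_reflect_zero[OF True]] eval])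
    then show ?thesis by (simp add: o_def conv_def)
  next
    case False
    have "continuous_map M euclidean (\<lambda>\<nu>. 0 :: complex)" by simp
    then show ?thesis
      by (rule continuous_map_eq) (use False in \<open>simp add: M tb_measures_def radon_measures_def\<close>)
  qed
  then have id_M: "continuous_map M euclidean (\<lambda>\<nu>. \<nu>)" by (simp add: continuous_map_into_fun)

  have i_iii: "subtopology vague_topology H = subtopology M H" if "\<mu> \<in> AP"
    unfolding H_vague
  proof (rule topology_eqI_continuous_map_id)
    show "continuous_map (subtopology M H) (top_of_set H) (\<lambda>\<nu>. \<nu>)"
      using id_M by (simp add: continuous_map_in_subtopology continuous_map_from_subtopology)
    have "continuous_map (top_of_set H) T (conv c)" if c: "c \<in> Cc" for c
    proof -
      define K where "K = T closure_of range (\<lambda>t. translate t (conv c \<mu>))"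
      have K: "compactin T K" "range (\<lambda>t. translate t (conv c \<mu>)) \<subseteq> topspace T"
        using \<open>\<mu> \<in> AP\<close> c by (auto simp: AP precompact_in_def K_def)
      have top: "topspace (subtopology T K) = K"
        using compactin_subset_topspace[OF K(1)] by auto
      have id_K: "continuous_map (subtopology T K) (top_of_set K) (\<lambda>f. f)"
        using id_T by (simp add: continuous_map_in_subtopology continuous_map_from_subtopology)
      have "compactin euclidean ((\<lambda>f. f) ` K)" by (rule image_compactin[OF K(1) id_T])
      then have "closed K" by (simp add: compact_imp_closed_fun)
      have "homeomorphic_map (subtopology T K) (top_of_set K) (\<lambda>f. f)"
        using id_K K(1) top
        by (intro continuous_imp_homeomorphic_map)
          (simp_all add: compact_space_subtopology Hausdorff_space_subtopology Hausdorff_space_euclidean_fun)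
      \<comment> \<open>The inverse homeomorphism \<open>g\<close> can only be the identity on
        \<open>K\<close>, which is thus continuous from the pointwise topology back into
        \<open>T\<close>.\<close>
      then obtain g where "homeomorphic_maps (subtopology T K) (top_of_set K) (\<lambda>f. f) g"
        using homeomorphic_map_maps by blast
      then have "continuous_map (top_of_set K) (subtopology T K) g" "\<And>f. f \<in> K \<Longrightarrow> g f = f"
        by (auto simp: homeomorphic_maps_def top)
      then have id_K': "continuous_map (top_of_set K) (subtopology T K) (\<lambda>f. f)"
        by (elim continuous_map_eq) simp
      have cont: "continuous_on UNIV (conv c :: 'g functional \<Rightarrow> 'g \<Rightarrow> complex)"
        unfolding conv_def
        by (intro continuous_on_coordinatewise_then_product continuous_on_product_coordinates)
      \<comment> \<open>The orbit of \<open>\<mu>\<close> is sent into \<open>K\<close>; as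
        \<open>K\<close> is pointwise closed and \<open>conv c\<close> pointwise continuous, so is
        the whole hull.\<close>
      have "conv c ` orbit \<mu> \<subseteq> K"
        using closure_of_subset[OF K(2)] by (auto simp: orbit_def K_def simp flip: translate_conv)
      then have "conv c ` H \<subseteq> K" unfolding H_eq
        using \<open>closed K\<close> continuous_on_subset[OF cont] by (intro image_closure_subset) auto
      then have "continuous_map (top_of_set H) (top_of_set K) (conv c)"
        using continuous_on_subset[OF cont] by (auto simp: continuous_map_in_subtopology)
      from continuous_map_compose[OF this id_K'] show ?thesis
        by (simp add: o_def continuous_map_in_subtopology)
    qed
    then have "continuous_map (top_of_set H) M (\<lambda>\<nu>. \<nu>)"
      using H_tb by (intro initial) simp_all
    then show "continuous_map (top_of_set H) (subtopology M H) (\<lambda>\<nu>. \<nu>)"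
      by (simp add: continuous_map_in_subtopology)
  qed

  have iii_ii: "H = M closure_of orbit \<mu> \<and> compactin M H"
    if eq: "subtopology vague_topology H = subtopology M H"
  proof
    have "compact_space (subtopology M H)"
      using H_compact by (simp flip: eq add: H_vague compact_space_subtopology)
    then show "compactin M H" using H_tb by (simp add: compactin_subspace M)
    show "H = M closure_of orbit \<mu>"
    proof
      have "H = (top_of_set H) closure_of orbit \<mu>"
        using orbit_H by (simp add: closure_of_subtopology H_eq Int_absorb1)
      also have "\<dots> = (subtopology M H) closure_of orbit \<mu>" using eq by (simp add: H_vague)
      also have "\<dots> \<subseteq> M closure_of orbit \<mu>" by (rule closure_of_subtopology_subset)
      finally show "H \<subseteq> M closure_of orbit \<mu>" .
      \<comment> \<open>\<open>M\<close> refines pointwise convergence, so a closure in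
        \<open>M\<close> cannot exceed the pointwise closure.\<close>
      show "M closure_of orbit \<mu> \<subseteq> H"
        using continuous_map_image_closure_subset[OF id_M, of "orbit \<mu>"] by (simp add: H_eq)
    qed
  qed

  have ii_iv: "H \<subseteq> AP" if compact: "compactin M H"
  proof
    fix \<nu> assume \<nu>: "\<nu> \<in> H"
    have "precompact_in T (range (\<lambda>t. translate t (conv c \<nu>)))" if c: "c \<in> Cc" for c
    proof -
      have Q: "compactin T (conv c ` H)" by (rule image_compactin[OF compact conv[OF c]])
      \<comment> \<open>Translation invariance of the hull makes the argument work for every
        \<open>\<nu>\<close> in it, not just for \<open>\<mu>\<close>.\<close>
      have sub: "range (\<lambda>t. translate t (conv c \<nu>)) \<subseteq> conv c ` H"
        using vague_hull_translate[OF \<mu>] \<nu> by (auto simp: translate_conv H_def)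
      \<comment> \<open>\<open>T\<close> refines a Hausdorff topology; hence the compact image of
        the hull is closed and contains the closure of the orbit.\<close>
      have "Hausdorff_space T"
        by (rule Hausdorff_space_injective_preimage[OF Hausdorff_space_euclidean_fun id_T]) simp
      then have "closedin T (conv c ` H)" by (rule compactin_imp_closedin[OF _ Q])
      then have "T closure_of range (\<lambda>t. translate t (conv c \<nu>)) \<subseteq> conv c ` H"
        by (rule closure_of_minimal[OF sub])
      then have "compactin T (T closure_of range (\<lambda>t. translate t (conv c \<nu>)))"
        by (rule closed_compactin[OF Q]) simp
      then show ?thesis
        using sub compactin_subset_topspace[OF Q] by (auto simp: precompact_in_def)
    qed
    then show "\<nu> \<in> AP" using \<nu> H_tb by (auto simp: AP)
  qed

  \<comment> \<open>\<open>\<mu>\<close> lies in its own hull, which leads from (iv) back to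
    (i).\<close>
  show ?thesis
    using i_iii iii_ii ii_iv \<mu>_H unfolding H_def by blast
qed

theorem proposition3p11:
  fixes \<mu> :: "'g::{topological_ab_group_add, t2_space} functional"
  assumes "locally_compact_space (euclidean :: 'g topology)"
    and "\<mu> \<in> tb_measures"
  shows
    "((\<mu> \<in> WAP \<longleftrightarrow>
         vague_hull \<mu> = weak_topology_measures closure_of orbit \<mu> \<and>
         compactin weak_topology_measures (vague_hull \<mu>)) \<and>
      (\<mu> \<in> WAP \<longleftrightarrow>
         subtopology vague_topology (vague_hull \<mu>) =
         subtopology weak_topology_measures (vague_hull \<mu>)) \<and>
      (\<mu> \<in> WAP \<longleftrightarrow> vague_hull \<mu> \<subseteq> WAP)) \<and>
     ((\<mu> \<in> SAP \<longleftrightarrow>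
         vague_hull \<mu> = product_topology_measures closure_of orbit \<mu> \<and>
         compactin product_topology_measures (vague_hull \<mu>)) \<and>
      (\<mu> \<in> SAP \<longleftrightarrow>
         subtopology vague_topology (vague_hull \<mu>) =
         subtopology product_topology_measures (vague_hull \<mu>)) \<and>
      (\<mu> \<in> SAP \<longleftrightarrow> vague_hull \<mu> \<subseteq> SAP))"
proof (rule conjI)
  note lc = assms(1)
  show "(\<mu> \<in> WAP \<longleftrightarrow>
         vague_hull \<mu> = weak_topology_measures closure_of orbit \<mu> \<and>
         compactin weak_topology_measures (vague_hull \<mu>)) \<and>
      (\<mu> \<in> WAP \<longleftrightarrow>
         subtopology vague_topology (vague_hull \<mu>) =
         subtopology weak_topology_measures (vague_hull \<mu>)) \<and>
      (\<mu> \<in> WAP \<longleftrightarrow> vague_hull \<mu> \<subseteq> WAP)"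
    \<comment> \<open>The abstract form of \<open>AP\<close> speaks of precompact orbits only; the
      membership in \<open>Cu\<close> that almost periodicity includes is supplied by
      \<open>conv_in_Cu\<close>.\<close>
    by (rule almost_periodic_hull_equivalences[OF assms continuous_map_eval_weak_Cu
          topspace_weak_topology_measures continuous_map_conv_weak[OF lc]
          continuous_map_into_weak_topology_measures[OF lc]])
      (auto simp: WAP_def weakly_almost_periodic_def intro: conv_in_Cu[OF lc])
  show "(\<mu> \<in> SAP \<longleftrightarrow>
         vague_hull \<mu> = product_topology_measures closure_of orbit \<mu> \<and>
         compactin product_topology_measures (vague_hull \<mu>)) \<and>
      (\<mu> \<in> SAP \<longleftrightarrow>
         subtopology vague_topology (vague_hull \<mu>) =
         subtopology product_topology_measures (vague_hull \<mu>)) \<and>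
      (\<mu> \<in> SAP \<longleftrightarrow> vague_hull \<mu> \<subseteq> SAP)"
    by (rule almost_periodic_hull_equivalences[OF assms continuous_map_eval_Cu
          topspace_product_topology_measures continuous_map_conv_product[OF lc]
          continuous_map_into_product_topology_measures[OF lc]])
      (auto simp: SAP_def bohr_almost_periodic_def intro: conv_in_Cu[OF lc])
qed

end
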